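(* Let $p\geq 3$ be a rational prime and let $f=\sum a_n(f)q^n$ be a $p$-ordinary primitive cuspidal eigenform of weight $k\geq 2$ and level $N$ with $\gcd(N,p)=1$. Suppose that for every integer $m\geq 1$ there exists a CM cuspidal eigenform $h_m$ which is a companion form of $f$ modulo $p^m$. Then $f$ has CM.
   Context: A primitive form is a normalised newform that is an eigenform for all Hecke operators. For a cusp form $f$ with coefficient field $K_f$ and a place $\mathfrak p\mid p$ of $K_f$, $\rho_f$ denotes the associated $p$-adic Galois representation (with values in the ring of integers of a finite extension of $\mathbb Q_p$), and $\rho_{f,m}$ its reduction modulo $p^m$ (congruences between algebraic integers modulo $p^m$ understood in suitable finite extensions). $\chi$ is the $p$-adic cyclotomic character. A form $f$ is $p$-ordinary if $a_p(f)\not\equiv 0\pmod{\mathfrak p}$ for every prime $\mathfrak p\mid p$ of $K_f$. A newform has complex multiplication (CM) by a nontrivial quadratic character $\phi$ if $a_q(f)=\phi(q)a_q(f)$ for almost all primes $q$; a cuspidal eigenform is called CM if it has CM by some nontrivial quadratic character. Let $k_m\geq 2$ be the smallest integer with $k_m+k-2\equiv 0 \pmod{p^{m-1}(p-1)}$. A companion form of $f$ modulo $p^m$ is a $p$-ordinary normalised eigenform $g$ of weight $k_m$ with $\rho_{f,m}\simeq\rho_{g,m}\otimes\chi^{k-1}\pmod{p^m}$; equivalently, $a_n(f)\equiv n^{k-1}a_n(g)\pmod{p^m}$ for all $n$ with $\gcd(n,Np)=1$. *)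

theory Defs
  imports
    "HOL-Analysis.Analysis"
    "HOL-Complex_Analysis.Complex_Analysis"
    "HOL-Number_Theory.Cong"
    "HOL-Algebra.Ideal"
    "HOL-Algebra.Generated_Fields"
begin

subsection \<open>Cusp forms on \<open>\<Gamma>\<^sub>1(N)\<close>\<close>

definition upper_half_plane :: "complex set" where
  "upper_half_plane = {z. Im z > 0}"

definition SL2Z :: "(int^2^2) set" where
  "SL2Z = {A. det A = 1}"

definition Gamma0 :: "nat \<Rightarrow> (int^2^2) set" where
  "Gamma0 N = {A \<in> SL2Z. [A $ 2 $ 1 = 0] (mod int N)}"

definition Gamma1 :: "nat \<Rightarrow> (int^2^2) set" where
  "Gamma1 N = {A \<in> SL2Z. [A $ 2 $ 1 = 0] (mod int N) \<and>
      [A $ 1 $ 1 = 1] (mod int N) \<and> [A $ 2 $ 2 = 1] (mod int N)}"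

text \<open>Functions on the upper half plane are represented by functions on \<^typ>\<open>complex\<close>
  that vanish off the upper half plane, so that equality of forms is equality of functions.
  The slash operator is only used for matrices of determinant 1.\<close>

definition slash :: "nat \<Rightarrow> int^2^2 \<Rightarrow> (complex \<Rightarrow> complex) \<Rightarrow> complex \<Rightarrow> complex" where
  "slash k A f z =
     (if z \<in> upper_half_plane
      then f ((of_int (A $ 1 $ 1) * z + of_int (A $ 1 $ 2)) /
              (of_int (A $ 2 $ 1) * z + of_int (A $ 2 $ 2)))
           / (of_int (A $ 2 $ 1) * z + of_int (A $ 2 $ 2)) ^ k
      else 0)"

text \<open>The last condition is vanishing at all cusps. The group \<open>\<Gamma>\<^sub>1(N)\<close> contains the normal
  subgroup \<open>\<Gamma>(N)\<close>, so each \<open>f|A\<close> has period \<open>N\<close> and its expansion is in powers of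
  \<open>exp(2\<pi>iz/N)\<close>.\<close>

definition cusp_forms :: "nat \<Rightarrow> nat \<Rightarrow> (complex \<Rightarrow> complex) set" where
  "cusp_forms k N = {f.
      f holomorphic_on upper_half_plane \<and>
      (\<forall>z. z \<notin> upper_half_plane \<longrightarrow> f z = 0) \<and>
      (\<forall>A \<in> Gamma1 N. slash k A f = f) \<and>
      (\<forall>A \<in> SL2Z. \<exists>c :: nat \<Rightarrow> complex. c 0 = 0 \<and>
         (\<forall>z \<in> upper_half_plane.
            (\<lambda>n. c n * exp (2 * of_real pi * \<i> * of_nat n * z / of_nat N)) sums slash k A f z))}"

definition fourier_coeff :: "(complex \<Rightarrow> complex) \<Rightarrow> nat \<Rightarrow> complex" where
  "fourier_coeff f = (THE c. \<forall>z \<in> upper_half_plane.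
      (\<lambda>n. c n * exp (2 * of_real pi * \<i> * of_nat n * z)) sums f z)"


subsection \<open>Hecke operators and eigenforms\<close>

text \<open>On \<open>\<Gamma>\<^sub>1(N)\<close>-invariant functions the diamond operator does not depend on the
  matrix chosen.\<close>

definition diamond :: "nat \<Rightarrow> nat \<Rightarrow> nat \<Rightarrow> (complex \<Rightarrow> complex) \<Rightarrow> complex \<Rightarrow> complex" where
  "diamond k N d f = slash k (SOME A. A \<in> Gamma0 N \<and> [A $ 2 $ 2 = int d] (mod int N)) f"

text \<open>The matrices \<open>(a b; 0 n/a)\<close>, twisted by \<open>\<langle>a\<rangle>\<close>, represent the cosets defining \<open>T\<^sub>n\<close>.
  For a prime \<open>n\<close> dividing \<open>N\<close> only \<open>a = 1\<close> remains and this is the operator \<open>U\<^sub>n\<close>.\<close>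

definition hecke :: "nat \<Rightarrow> nat \<Rightarrow> nat \<Rightarrow> (complex \<Rightarrow> complex) \<Rightarrow> complex \<Rightarrow> complex" where
  "hecke k N n f z =
     of_nat n powi (int k - 1) *
     (\<Sum>a \<in> {a. a dvd n \<and> coprime a N}. \<Sum>b < n div a.
        diamond k N a f ((of_nat a * z + of_nat b) / of_nat (n div a)) / of_nat (n div a) ^ k)"

definition cuspidal_eigenform :: "nat \<Rightarrow> nat \<Rightarrow> (complex \<Rightarrow> complex) \<Rightarrow> bool" where
  "cuspidal_eigenform k N f \<longleftrightarrow>
     f \<in> cusp_forms k N \<and> f \<noteq> (\<lambda>_. 0) \<and>
     (\<forall>n \<ge> 1. \<exists>c. hecke k N n f = (\<lambda>z. c * f z)) \<and>
     (\<forall>d. coprime d N \<longrightarrow> (\<exists>c. diamond k N d f = (\<lambda>z. c * f z)))"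

definition normalised :: "(complex \<Rightarrow> complex) \<Rightarrow> bool" where
  "normalised f \<longleftrightarrow> fourier_coeff f 1 = 1"


subsection \<open>Newforms\<close>

definition fundamental_domain :: "complex set" where
  "fundamental_domain = {z \<in> upper_half_plane. \<bar>Re z\<bar> \<le> 1/2 \<and> 1 \<le> norm z}"

definition Gamma1_cosets :: "nat \<Rightarrow> (int^2^2) set set" where
  "Gamma1_cosets N = (\<lambda>A. (\<lambda>G. G ** A) ` Gamma1 N) ` SL2Z"

text \<open>The translates of the standard fundamental domain by coset representatives of
  \<open>\<Gamma>\<^sub>1(N)\<setminus>SL\<^sub>2(\<int>)\<close> cover a fundamental domain for \<open>\<Gamma>\<^sub>1(N)\<close>, once if \<open>-1 \<in> \<Gamma>\<^sub>1(N)\<close> and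
  twice otherwise; dividing by the index times the volume \<open>\<pi>/3\<close> gives the inner product
  normalised by the volume of \<open>X\<^sub>1(N)\<close> in both cases.\<close>

definition petersson :: "nat \<Rightarrow> nat \<Rightarrow> (complex \<Rightarrow> complex) \<Rightarrow> (complex \<Rightarrow> complex) \<Rightarrow> complex" where
  "petersson k N f g =
     (\<Sum>C \<in> Gamma1_cosets N.
        let A = (SOME A. A \<in> C) in
        set_lebesgue_integral lborel fundamental_domain
          (\<lambda>z. slash k A f z * cnj (slash k A g z) * of_real (Im z ^ k / Im z ^ 2)))
     / of_real (pi / 3 * real (card (Gamma1_cosets N)))"

inductive_set oldspace :: "nat \<Rightarrow> nat \<Rightarrow> (complex \<Rightarrow> complex) set" for k N where
  zero: "(\<lambda>_. 0) \<in> oldspace k N"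
| lift: "M dvd N \<Longrightarrow> M < N \<Longrightarrow> d dvd N div M \<Longrightarrow> g \<in> cusp_forms k M
           \<Longrightarrow> (\<lambda>z. g (of_nat d * z)) \<in> oldspace k N"
| add: "f \<in> oldspace k N \<Longrightarrow> g \<in> oldspace k N \<Longrightarrow> (\<lambda>z. f z + g z) \<in> oldspace k N"
| scale: "f \<in> oldspace k N \<Longrightarrow> (\<lambda>z. c * f z) \<in> oldspace k N"

definition newspace :: "nat \<Rightarrow> nat \<Rightarrow> (complex \<Rightarrow> complex) set" where
  "newspace k N = {f \<in> cusp_forms k N. \<forall>g \<in> oldspace k N. petersson k N f g = 0}"

definition primitive_form :: "nat \<Rightarrow> nat \<Rightarrow> (complex \<Rightarrow> complex) \<Rightarrow> bool" where
  "primitive_form k N f \<longleftrightarrow> f \<in> newspace k N \<and> cuspidal_eigenform k N f \<and> normalised f"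


subsection \<open>Coefficient fields, places and ordinarity\<close>

definition complex_ring :: "complex ring" where
  "complex_ring = \<lparr>carrier = UNIV, monoid.mult = (*), one = 1, ring.zero = 0, add = (+)\<rparr>"

definition coeff_field :: "(complex \<Rightarrow> complex) \<Rightarrow> complex set" where
  "coeff_field f = generate_field complex_ring {fourier_coeff f n | n. n \<ge> 1}"

definition integers_of :: "complex set \<Rightarrow> complex set" where
  "integers_of K = {x \<in> K. algebraic_int x}"

definition primes_above :: "nat \<Rightarrow> complex set \<Rightarrow> complex set set" where
  "primes_above p K =
     {P. primeideal P (complex_ring\<lparr>carrier := integers_of K\<rparr>) \<and> of_nat p \<in> P}"

definition Qbar :: "complex set" where
  "Qbar = {x. algebraic x}"

definition p_ordinary :: "nat \<Rightarrow> (complex \<Rightarrow> complex) \<Rightarrow> bool" where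
  "p_ordinary p f \<longleftrightarrow> (\<forall>P \<in> primes_above p (coeff_field f). fourier_coeff f p \<notin> P)"

text \<open>For a prime \<open>P\<close> of the ring of all algebraic integers above \<open>p\<close> (that is, up to
  conjugation, an embedding of the algebraic numbers into an algebraic closure of \<open>\<rat>\<^sub>p\<close>), the
  following says that \<open>x - y\<close> lies in \<open>p\<^sup>m\<close> times the localisation at \<open>P\<close>; equivalently, in
  \<open>p\<^sup>m\<close> times the ring of integers of any finite extension of \<open>\<rat>\<^sub>p\<close> containing the images of
  \<open>x\<close> and \<open>y\<close>.\<close>

definition cong_at :: "complex set \<Rightarrow> nat \<Rightarrow> nat \<Rightarrow> complex \<Rightarrow> complex \<Rightarrow> bool" where
  "cong_at P p m x y \<longleftrightarrow>
     (\<exists>s \<in> integers_of Qbar - P. \<exists>t \<in> integers_of Qbar. s * (x - y) = of_nat p ^ m * t)"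


subsection \<open>Complex multiplication\<close>

definition dirichlet_character :: "nat \<Rightarrow> (nat \<Rightarrow> complex) \<Rightarrow> bool" where
  "dirichlet_character D \<phi> \<longleftrightarrow> D \<ge> 1 \<and> \<phi> 1 = 1 \<and>
     (\<forall>a b. \<phi> (a * b) = \<phi> a * \<phi> b) \<and> (\<forall>a. \<phi> (a + D) = \<phi> a) \<and>
     (\<forall>a. \<phi> a \<noteq> 0 \<longleftrightarrow> coprime a D)"

definition nontrivial_quadratic_character :: "nat \<Rightarrow> (nat \<Rightarrow> complex) \<Rightarrow> bool" where
  "nontrivial_quadratic_character D \<phi> \<longleftrightarrow> dirichlet_character D \<phi> \<and>
     (\<forall>a. coprime a D \<longrightarrow> \<phi> a ^ 2 = 1) \<and> (\<exists>a. coprime a D \<and> \<phi> a \<noteq> 1)"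

definition has_CM_by :: "(complex \<Rightarrow> complex) \<Rightarrow> (nat \<Rightarrow> complex) \<Rightarrow> bool" where
  "has_CM_by f \<phi> \<longleftrightarrow>
     finite {q. prime q \<and> fourier_coeff f q \<noteq> \<phi> q * fourier_coeff f q}"

definition has_CM :: "(complex \<Rightarrow> complex) \<Rightarrow> bool" where
  "has_CM f \<longleftrightarrow> (\<exists>D \<phi>. nontrivial_quadratic_character D \<phi> \<and> has_CM_by f \<phi>)"


subsection \<open>Companion forms\<close>

definition companion_weight :: "nat \<Rightarrow> nat \<Rightarrow> nat \<Rightarrow> nat" where
  "companion_weight p m k =
     (LEAST j. j \<ge> 2 \<and> [int j + int k - 2 = 0] (mod int (p ^ (m - 1) * (p - 1))))"

text \<open>\<open>g\<close>, of level \<open>M\<close>, is a companion modulo \<open>p\<^sup>m\<close> of \<open>f\<close>, of weight \<open>k\<close> and level \<open>N\<close>. The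
  isomorphism \<open>\<rho>\<^bsub>f,m\<^esub> \<simeq> \<rho>\<^bsub>g,m\<^esub> \<otimes> \<chi>\<^bsup>k-1\<^esup>\<close> is expressed through Fourier coefficients.\<close>

definition companion_form ::
  "complex set \<Rightarrow> nat \<Rightarrow> nat \<Rightarrow> nat \<Rightarrow> nat \<Rightarrow> (complex \<Rightarrow> complex) \<Rightarrow> nat \<Rightarrow> (complex \<Rightarrow> complex) \<Rightarrow> bool"
where
  "companion_form P p m k N f M g \<longleftrightarrow>
     cuspidal_eigenform (companion_weight p m k) M g \<and> normalised g \<and> p_ordinary p g \<and>
     (\<forall>n. coprime n (N * p) \<longrightarrow>
        cong_at P p m (fourier_coeff f n) (of_nat n ^ (k - 1) * fourier_coeff g n))"

end

theory Submission imports Defs begin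

text \<open>
  A companion \<open>h\<close> with CM by \<open>\<phi>\<close> modulo \<open>D\<close> has \<open>a\<^sub>n(h) = 0\<close> whenever \<open>n\<close> avoids a finite set of primes
  and \<open>\<phi>(n) = -1\<close>. The level of \<open>h\<close> is only divisible by primes dividing \<open>Np\<close>, because at any other
  such prime the Euler factor of \<open>h\<close> has degree 1 and that of \<open>f\<close> has degree 2. For a prime \<open>q\<close> not
  dividing the level, a nonzero form has a nonzero Fourier coefficient in every residue class of
  units modulo \<open>q\<close>. Hence the exceptional primes play no role and \<open>\<phi>\<close> is induced from a quadratic
  character modulo \<open>8Np\<close>. There are finitely many of these, so one of them, \<open>\<psi>\<close>, serves infinitely many
  exponents \<open>m\<close>. If \<open>\<psi>(n) = -1\<close>, then \<open>a\<^sub>n(f)\<close> is divisible by infinitely many powers of \<open>p\<close>, so it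
  vanishes.
\<close>

subsection \<open>Fourier expansions\<close>

definition ee :: "complex \<Rightarrow> complex" where
  "ee z = exp (2 * of_real pi * \<i> * z)"

lemma ee_add: "ee (x + y) = ee x * ee y"
  by (simp add: ee_def distrib_left exp_add)

lemma ee_of_nat_mult: "ee (of_nat n * z) = ee z ^ n"
  unfolding ee_def exp_of_nat_mult[symmetric] by (simp add: mult_ac)

lemma ee_eq_1_iff: "ee z = 1 \<longleftrightarrow> (\<exists>n. z = of_int n)"
  unfolding ee_def exp_eq_1 by (auto simp: complex_eq_iff)

lemma ee_of_int [simp]: "ee (of_int n) = 1"
  by (auto simp: ee_eq_1_iff)

lemma ee_of_nat [simp]: "ee (of_nat n) = 1"
  using ee_of_int[of "int n"] by simp

lemma ee_surj_punctured_disc: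
  assumes "w \<noteq> 0" "norm w < 1"
  obtains z where "Im z > 0" "ee z = w"
proof
  define z where "z = Ln w / (2 * of_real pi * \<i>)"
  show "ee z = w" using assms(1) by (simp add: ee_def z_def)
  have "Im z = - Re (Ln w) / (2 * pi)"
    by (simp add: z_def Im_divide power2_eq_square field_simps)
  also have "\<dots> = - ln (norm w) / (2 * pi)" using assms(1) by simp
  also have "\<dots> > 0" using assms by (intro divide_pos_pos) auto
  finally show "Im z > 0" .
qed

definition qexp :: "(nat \<Rightarrow> complex) \<Rightarrow> (complex \<Rightarrow> complex) \<Rightarrow> bool" where
  "qexp b F \<longleftrightarrow> (\<forall>z. Im z > 0 \<longrightarrow> (\<lambda>n. b n * ee (of_nat n * z)) sums F z)"

lemma qexpD: "qexp b F \<Longrightarrow> Im z > 0 \<Longrightarrow> (\<lambda>n. b n * ee (of_nat n * z)) sums F z"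
  by (simp add: qexp_def)

lemma powser_zero_coeff:
  fixes d :: "nat \<Rightarrow> complex"
  assumes "\<And>w. w \<noteq> 0 \<Longrightarrow> norm w < 1 \<Longrightarrow> (\<lambda>n. d n * w ^ n) sums 0"
  shows "d n = 0"
  using assms
proof (induction n arbitrary: d)
  case 0
  have "((\<lambda>_. 0) \<longlongrightarrow> d 0) (at (0::complex))"
    by (rule powser_limit_0_strong[of 1]) (use 0 in auto)
  thus ?case by (simp add: tendsto_const_iff)
next
  case (Suc n)
  have "((\<lambda>_. 0) \<longlongrightarrow> d 0) (at (0::complex))"
    by (rule powser_limit_0_strong[of 1]) (use Suc.prems in auto)
  hence d0: "d 0 = 0" by (simp add: tendsto_const_iff)
  have "(\<lambda>n. d (Suc n) * w ^ n) sums 0" if w: "w \<noteq> 0" "norm w < 1" for w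
  proof -
    have "(\<lambda>n. d (Suc n) * w ^ Suc n) sums 0"
      using Suc.prems[OF w] by (subst sums_Suc_iff) (simp add: d0)
    from sums_mult[OF this, of "inverse w"] show ?thesis
      using w by (simp add: field_simps)
  qed
  from Suc.IH[of "\<lambda>n. d (Suc n)", OF this] show ?case .
qed

lemma qexp_unique:
  assumes "qexp b F" "qexp b' F"
  shows "b = b'"
proof
  fix n
  have "b n - b' n = 0"
  proof (rule powser_zero_coeff[of "\<lambda>n. b n - b' n"])
    fix w :: complex assume "w \<noteq> 0" "norm w < 1"
    then obtain z where z: "Im z > 0" "ee z = w" by (rule ee_surj_punctured_disc)
    from sums_diff[OF qexpD[OF assms(1) z(1)] qexpD[OF assms(2) z(1)]]
    show "(\<lambda>n. (b n - b' n) * w ^ n) sums 0"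
      by (simp add: ee_of_nat_mult z(2) left_diff_distrib)
  qed
  thus "b n = b' n" by simp
qed

lemma qexp_translate:
  assumes "qexp b F"
  shows "qexp (\<lambda>n. ee (of_nat n * of_real t) * b n) (\<lambda>z. F (z + of_real t))"
  unfolding qexp_def
proof (intro allI impI)
  fix z assume "Im z > 0"
  hence "Im (z + of_real t) > 0" by simp
  from qexpD[OF assms this]
  show "(\<lambda>n. ee (of_nat n * of_real t) * b n * ee (of_nat n * z)) sums F (z + of_real t)"
    by (simp add: ee_add distrib_left mult_ac)
qed

lemma qexp_cmult: "qexp b F \<Longrightarrow> qexp (\<lambda>n. c * b n) (\<lambda>z. c * F z)"
  unfolding qexp_def by (metis (no_types, lifting) mult.assoc sums_cong sums_mult)

lemma qexp_sum:
  assumes "\<And>i. i \<in> I \<Longrightarrow> qexp (b i) (F i)"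
  shows "qexp (\<lambda>n. \<Sum>i\<in>I. b i n) (\<lambda>z. \<Sum>i\<in>I. F i z)"
  unfolding qexp_def sum_distrib_right
  using assms by (auto intro!: sums_sum simp: qexp_def)

lemma sum_ee_div:
  assumes "Q \<ge> 1"
  shows "(\<Sum>u<Q. ee (of_int j * of_nat u / of_nat Q)) = (if int Q dvd j then of_nat Q else 0)"
proof -
  define x where "x = ee (of_int j / of_nat Q)"
  have xu: "ee (of_int j * of_nat u / of_nat Q) = x ^ u" for u
    unfolding x_def ee_of_nat_mult[symmetric] by (simp add: mult_ac)
  have x1: "x = 1 \<longleftrightarrow> int Q dvd j"
  proof
    assume "x = 1"
    then obtain n :: int where "of_int j / of_nat Q = (of_int n :: complex)"
      by (auto simp: x_def ee_eq_1_iff)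
    hence "(of_int j :: complex) = of_int (n * int Q)" using assms by (simp add: field_simps)
    thus "int Q dvd j" by (metis dvd_triv_right of_int_eq_iff)
  next
    assume "int Q dvd j"
    then obtain n where "j = int Q * n" by blast
    thus "x = 1" using assms by (simp add: x_def)
  qed
  have xQ: "x ^ Q = 1"
    unfolding x_def ee_of_nat_mult[symmetric] using assms by simp
  show ?thesis
  proof (cases "x = 1")
    case True
    thus ?thesis using x1 by (simp add: xu)
  next
    case False
    thus ?thesis using x1 xQ by (simp add: xu sum_gp_strict)
  qed
qed

definition dft :: "nat \<Rightarrow> (nat \<Rightarrow> complex) \<Rightarrow> nat \<Rightarrow> complex" where
  "dft Q \<psi> u = (\<Sum>r<Q. \<psi> r * ee (- (of_nat r * of_nat u / of_nat Q))) / of_nat Q"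

lemma dft_inversion:
  assumes "Q \<ge> 1" "\<And>n. \<psi> (n mod Q) = \<psi> n"
  shows "(\<Sum>u<Q. dft Q \<psi> u * ee (of_nat n * of_nat u / of_nat Q)) = \<psi> n"
proof -
  have "(\<Sum>u<Q. dft Q \<psi> u * ee (of_nat n * of_nat u / of_nat Q)) =
      (\<Sum>u<Q. \<Sum>r<Q. \<psi> r * ee (of_int (int n - int r) * of_nat u / of_nat Q)) / of_nat Q"
    unfolding dft_def sum_divide_distrib sum_distrib_right
    by (intro sum.cong refl) (simp add: ee_add[symmetric] diff_divide_distrib left_diff_distrib)
  also have "(\<Sum>u<Q. \<Sum>r<Q. \<psi> r * ee (of_int (int n - int r) * of_nat u / of_nat Q)) =
      (\<Sum>r<Q. \<psi> r * (\<Sum>u<Q. ee (of_int (int n - int r) * of_nat u / of_nat Q)))"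
    unfolding sum_distrib_left by (rule sum.swap)
  also have "\<dots> = (\<Sum>r<Q. if r = n mod Q then \<psi> r * of_nat Q else 0)"
  proof (intro sum.cong refl)
    fix r assume r: "r \<in> {..<Q}"
    have "int Q dvd int n - int r \<longleftrightarrow> int n mod int Q = int r mod int Q"
      by (rule mod_eq_dvd_iff[symmetric])
    also have "\<dots> \<longleftrightarrow> n mod Q = r mod Q" by (metis of_nat_eq_iff zmod_int)
    also have "\<dots> \<longleftrightarrow> r = n mod Q" using r by auto
    finally show "\<psi> r * (\<Sum>u<Q. ee (of_int (int n - int r) * of_nat u / of_nat Q)) =
        (if r = n mod Q then \<psi> r * of_nat Q else 0)"
      using sum_ee_div[OF assms(1), of "int n - int r"] by auto
  qed
  also have "\<dots> = \<psi> (n mod Q) * of_nat Q" using assms(1) by simp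
  finally show ?thesis using assms by simp
qed

lemma qexp_sieve:
  assumes "qexp b F" "Q \<ge> 1" "\<And>n. \<psi> (n mod Q) = \<psi> n"
  shows "qexp (\<lambda>n. \<psi> n * b n) (\<lambda>z. \<Sum>u<Q. dft Q \<psi> u * F (z + of_real (real u / real Q)))"
proof -
  have "qexp (\<lambda>n. \<Sum>u<Q. dft Q \<psi> u * (ee (of_nat n * of_real (real u / real Q)) * b n))
     (\<lambda>z. \<Sum>u<Q. dft Q \<psi> u * F (z + of_real (real u / real Q)))"
    by (intro qexp_sum qexp_cmult qexp_translate assms)
  moreover have "(\<Sum>u<Q. dft Q \<psi> u * (ee (of_nat n * of_real (real u / real Q)) * b n)) = \<psi> n * b n" for n
    using dft_inversion[of Q \<psi> n] assms(2,3) by (simp add: sum_distrib_right[symmetric] mult.assoc[symmetric])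
  ultimately show ?thesis by simp
qed

lemma qexp_periodic_support:
  assumes e: "qexp b F" and Q: "Q > 0"
    and per: "\<And>z. Im z > 0 \<Longrightarrow> F (z + of_real (1 / real Q)) = F z" and n: "\<not> Q dvd n"
  shows "b n = 0"
proof -
  have "qexp (\<lambda>n. ee (of_nat n * of_real (1 / real Q)) * b n) F"
    using qexp_translate[OF e, of "1 / real Q"] per by (simp add: qexp_def)
  from qexp_unique[OF this e] have "ee (of_nat n * of_real (1 / real Q)) * b n = b n" by metis
  moreover have "ee (of_nat n * of_real (1 / real Q)) \<noteq> 1"
  proof
    assume "ee (of_nat n * of_real (1 / real Q)) = 1"
    then obtain m where "of_nat n * of_real (1 / real Q) = (of_int m :: complex)"
      by (auto simp: ee_eq_1_iff)
    hence "(of_int (int n) :: complex) = of_int (m * int Q)" using Q by (simp add: field_simps)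
    hence "int n = m * int Q" by (simp only: of_int_eq_iff)
    hence "int Q dvd int n" by simp
    thus False using n by simp
  qed
  ultimately show ?thesis by simp
qed

lemma qexp_contract:
  assumes e: "qexp b F" and Q: "Q > 0" and supp: "\<And>n. \<not> Q dvd n \<Longrightarrow> b n = 0"
  shows "qexp (\<lambda>m. b (Q * m)) (\<lambda>z. F (z / of_nat Q))"
  unfolding qexp_def
proof (intro allI impI)
  fix z assume z: "Im z > 0"
  have s: "(\<lambda>n. b n * ee (of_nat n * (z / of_nat Q))) sums F (z / of_nat Q)"
    by (rule qexpD[OF e]) (use z Q in simp)
  have "(\<lambda>m. b (Q * m) * ee (of_nat (Q * m) * (z / of_nat Q))) sums F (z / of_nat Q)"
  proof (subst sums_mono_reindex[of "\<lambda>m. Q * m" "\<lambda>n. b n * ee (of_nat n * (z / of_nat Q))"])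
    show "strict_mono ((*) Q)" using Q by (simp add: strict_mono_def)
  next
    fix n assume "n \<notin> range ((*) Q)"
    hence "\<not> Q dvd n" by auto
    thus "b n * ee (of_nat n * (z / of_nat Q)) = 0" by (simp add: supp)
  qed (rule s)
  thus "(\<lambda>m. b (Q * m) * ee (of_nat m * z)) sums F (z / of_nat Q)"
    using Q by simp
qed

lemma qexp_dilate:
  assumes e: "qexp b F" and Q: "Q > 0"
  shows "qexp (\<lambda>m. if Q dvd m then b (m div Q) else 0) (\<lambda>z. F (of_nat Q * z))"
  unfolding qexp_def
proof (intro allI impI)
  fix z assume z: "Im z > 0"
  let ?f = "\<lambda>m. (if Q dvd m then b (m div Q) else 0) * ee (of_nat m * z)"
  have "(\<lambda>n. b n * ee (of_nat n * (of_nat Q * z))) sums F (of_nat Q * z)"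
    by (rule qexpD[OF e]) (use z Q in simp)
  hence s: "(\<lambda>n. ?f (Q * n)) sums F (of_nat Q * z)"
    using Q by (simp add: mult_ac)
  show "?f sums F (of_nat Q * z)"
  proof (subst sums_mono_reindex[of "\<lambda>m. Q * m" ?f, symmetric])
    show "strict_mono ((*) Q)" using Q by (simp add: strict_mono_def)
  next
    fix n assume "n \<notin> range ((*) Q)"
    hence "\<not> Q dvd n" by auto
    thus "?f n = 0" by simp
  qed (rule s)
qed

lemma qexp_add: "qexp b F \<Longrightarrow> qexp b' G \<Longrightarrow> qexp (\<lambda>n. b n + b' n) (\<lambda>z. F z + G z)"
  unfolding qexp_def by (simp add: distrib_right sums_add)

lemma qexp_U:
  assumes e: "qexp b F" and Q: "Q > 0"
  shows "qexp (\<lambda>m. b (Q * m)) (\<lambda>z. (\<Sum>u<Q. F ((z + of_nat u) / of_nat Q)) / of_nat Q)"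
proof -
  define \<psi> :: "nat \<Rightarrow> complex" where "\<psi> = (\<lambda>n. if Q dvd n then 1 else 0)"
  have "(\<Sum>r<Q. \<psi> r * ee (- (of_nat r * of_nat u / of_nat Q))) = (\<Sum>r<Q. if r = 0 then 1 else 0)" for u
    using ee_of_nat[of 0]
    by (intro sum.cong) (auto simp: \<psi>_def dest: dvd_imp_le simp del: ee_of_nat)
  hence C: "dft Q \<psi> u = 1 / of_nat Q" for u
    using Q by (simp add: dft_def)
  have "qexp (\<lambda>n. \<psi> n * b n) (\<lambda>z. \<Sum>u<Q. dft Q \<psi> u * F (z + of_real (real u / real Q)))"
    by (rule qexp_sieve[OF e]) (use Q in \<open>auto simp: \<psi>_def dvd_mod_iff\<close>)
  from qexp_contract[OF this Q] show ?thesis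
    unfolding C by (simp add: \<psi>_def sum_divide_distrib add_divide_distrib)
qed

subsection \<open>Invariance under real matrices\<close>

definition rslash :: "nat \<Rightarrow> real \<Rightarrow> real \<Rightarrow> real \<Rightarrow> real \<Rightarrow> (complex \<Rightarrow> complex) \<Rightarrow> complex \<Rightarrow> complex" where
  "rslash k a b c d F z = F ((of_real a * z + of_real b) / (of_real c * z + of_real d))
     / (of_real c * z + of_real d) ^ k"

lemma moebius_denom_nonzero:
  assumes "a * d - b * c = (1::real)" "Im z > 0"
  shows "of_real c * z + of_real d \<noteq> (0::complex)"
proof
  assume *: "of_real c * z + of_real d = (0::complex)"
  hence "Im (of_real c * z + of_real d) = 0" by simp
  hence "c = 0" using assms(2) by simp
  with * have "d = 0" by simp
  with \<open>c = 0\<close> assms(1) show False by simp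
qed

lemma moebius_Im_pos:
  assumes "a * d - b * c = (1::real)" "Im z > 0"
  shows "Im ((of_real a * z + of_real b) / (of_real c * z + of_real d)) > 0"
proof -
  let ?w = "of_real c * z + of_real d"
  have "Im ((of_real a * z + of_real b) / ?w) =
      (a * Im z * (c * Re z + d) - (a * Re z + b) * (c * Im z)) / (norm ?w)\<^sup>2"
    by (simp add: Im_divide cmod_power2)
  also have "a * Im z * (c * Re z + d) - (a * Re z + b) * (c * Im z) = (a * d - b * c) * Im z"
    by (simp add: algebra_simps)
  finally show ?thesis
    using assms moebius_denom_nonzero[OF assms] by simp
qed

lemma rslash_comp:
  assumes "a * d - b * c = 1" "a' * d' - b' * c' = 1" "Im z > 0"
  shows "rslash k a' b' c' d' (rslash k a b c d F) z =
    rslash k (a * a' + b * c') (a * b' + b * d') (c * a' + d * c') (c * b' + d * d') F z"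
proof -
  let ?j' = "of_real c' * z + of_real d'"
  let ?z' = "(of_real a' * z + of_real b') / ?j'"
  have j': "?j' \<noteq> 0" by (rule moebius_denom_nonzero) (use assms in auto)
  have 1: "(of_real c * ?z' + of_real d) * ?j' =
      of_real (c * a' + d * c') * z + of_real (c * b' + d * d')"
    using j' by (simp add: field_simps)
  have 2: "(of_real a * ?z' + of_real b) * ?j' =
      of_real (a * a' + b * c') * z + of_real (a * b' + b * d')"
    using j' by (simp add: field_simps)
  have "(of_real a * ?z' + of_real b) / (of_real c * ?z' + of_real d) =
     ((of_real a * ?z' + of_real b) * ?j') / ((of_real c * ?z' + of_real d) * ?j')"
    using j' by simp
  moreover have "X / (of_real c * ?z' + of_real d) ^ k / ?j' ^ k =
    X / ((of_real c * ?z' + of_real d) * ?j') ^ k" for X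
    by (simp add: power_mult_distrib)
  ultimately show ?thesis
    unfolding rslash_def 1 2 by simp
qed

lemma rslash_cong:
  assumes "a * d - b * c = 1" "Im z > 0" "\<And>z. Im z > 0 \<Longrightarrow> F z = G z"
  shows "rslash k a b c d F z = rslash k a b c d G z"
  unfolding rslash_def using assms(3)[OF moebius_Im_pos[OF assms(1,2)]] by simp

lemma rslash_sum:
  "rslash k a b c d (\<lambda>z. \<Sum>i\<in>I. C i * F i z) z = (\<Sum>i\<in>I. C i * rslash k a b c d (F i) z)"
  by (simp add: rslash_def sum_divide_distrib)

lemma rslash_translation: "rslash k 1 t 0 1 F z = F (z + of_real t)"
  by (simp add: rslash_def)

definition stab :: "nat \<Rightarrow> (complex \<Rightarrow> complex) \<Rightarrow> real \<Rightarrow> real \<Rightarrow> real \<Rightarrow> real \<Rightarrow> bool" where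
  "stab k F a b c d \<longleftrightarrow> a * d - b * c = 1 \<and> (\<forall>z. Im z > 0 \<longrightarrow> rslash k a b c d F z = F z)"

lemma stabD: "stab k F a b c d \<Longrightarrow> Im z > 0 \<Longrightarrow> rslash k a b c d F z = F z"
  by (simp add: stab_def)

lemma stab_det: "stab k F a b c d \<Longrightarrow> a * d - b * c = 1"
  by (simp add: stab_def)

lemma rslash_stab_left:
  assumes "stab k F a b c d" "a' * d' - b' * c' = 1" "Im z > 0"
    and "A = a * a' + b * c'" "B = a * b' + b * d'" "C = c * a' + d * c'" "D = c * b' + d * d'"
  shows "rslash k A B C D F z = rslash k a' b' c' d' F z"
  using rslash_comp[OF stab_det[OF assms(1)] assms(2,3), of k F]
    rslash_cong[OF assms(2,3) stabD[OF assms(1)]] assms(4-) by simp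

lemma stab_mult:
  assumes "stab k F a b c d" "stab k F a' b' c' d'"
    and "A = a * a' + b * c'" "B = a * b' + b * d'" "C = c * a' + d * c'" "D = c * b' + d * d'"
  shows "stab k F A B C D"
proof -
  have "A * D - B * C = (a * d - b * c) * (a' * d' - b' * c')"
    unfolding assms(3-) by (simp add: algebra_simps)
  hence "A * D - B * C = 1" using assms by (simp add: stab_def)
  thus ?thesis
    using rslash_stab_left[OF assms(1) stab_det[OF assms(2)] _ assms(3-)] stabD[OF assms(2)]
    by (simp add: stab_def)
qed

lemma stab_inverse:
  assumes "stab k F a b c d"
  shows "stab k F d (- b) (- c) a"
proof -
  note det = stab_det[OF assms]
  have "rslash k d (- b) (- c) a F z = F z" if "Im z > 0" for z
  proof -
    have "rslash k 1 0 0 1 F z = rslash k d (- b) (- c) a F z"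
      by (rule rslash_stab_left[OF assms]) (use det that in \<open>auto simp: algebra_simps\<close>)
    thus ?thesis by (simp add: rslash_def)
  qed
  thus ?thesis using det by (simp add: stab_def algebra_simps)
qed

definition Gamma1_inv :: "nat \<Rightarrow> nat \<Rightarrow> (complex \<Rightarrow> complex) \<Rightarrow> bool" where
  "Gamma1_inv k L F \<longleftrightarrow> (\<forall>a b c d :: int. a * d - b * c = 1 \<longrightarrow> int L dvd c \<longrightarrow> int L dvd a - 1 \<longrightarrow>
     int L dvd d - 1 \<longrightarrow> stab k F (of_int a) (of_int b) (of_int c) (of_int d))"

lemma Gamma1_invD:
  assumes "Gamma1_inv k L F" "a * d - b * c = 1" "int L dvd c" "int L dvd a - 1" "int L dvd d - 1"
    and "A = of_int a" "B = of_int b" "C = of_int c" "D = of_int d"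
  shows "stab k F A B C D"
  using assms by (simp add: Gamma1_inv_def)

lemma stab_translation_power:
  assumes "stab k F 1 t 0 1"
  shows "stab k F 1 (of_int n * t) 0 1"
proof -
  have nat: "stab k F 1 (of_nat n * t) 0 1" for n
  proof (induction n)
    case 0
    thus ?case by (simp add: stab_def rslash_def)
  next
    case (Suc n)
    show ?case by (rule stab_mult[OF Suc assms]) (auto simp: algebra_simps)
  qed
  show ?thesis
  proof (cases "n \<ge> 0")
    case True
    thus ?thesis using nat[of "nat n"] by simp
  next
    case False
    thus ?thesis using stab_inverse[OF nat[of "nat (- n)"]] by simp
  qed
qed

lemma stab_conjugate:
  fixes a b c d :: int
  assumes inv: "Gamma1_inv k L F" and q: "prime q" and t: "stab k F 1 (1 / real q) 0 1"
    and det: "a * d - b * c = 1" and L: "int L dvd c" "int L dvd a - 1" "int L dvd d - 1"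
  shows "stab k F (of_int a) (of_int b / real q) (of_int c * real q) (of_int d)"
proof -
  have q0: "real q > 0" using q prime_gt_0_nat by simp
  have nondiv: "stab k F (of_int a) (of_int b / real q) (of_int c * real q) (of_int d)"
    if det: "a * d - b * c = 1" and L: "int L dvd c" "int L dvd a - 1" "int L dvd d - 1"
      and qd: "\<not> int q dvd d" for a b c d :: int
  proof -
    have "coprime (int q) d" using q qd by (intro prime_imp_coprime) auto
    hence "coprime d (int q)" by (simp add: coprime_commute)
    then obtain y where y: "[d * y = 1] (mod int q)" using cong_solve_coprime_int by blast
    define j where "j = - b * y"
    have "[b + j * d = b - b * (d * y)] (mod int q)" by (simp add: j_def algebra_simps)
    also have "[b - b * (d * y) = b - b * 1] (mod int q)"
      using y by (intro cong_diff cong_mult cong_refl)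
    finally have "int q dvd b + j * d" by (simp add: cong_0_iff)
    then obtain b' where b': "b + j * d = int q * b'" by blast
    have "(a + j * c) * d - b' * (c * int q) = a * d + j * c * d - c * (int q * b')"
      by (simp add: algebra_simps)
    also have "\<dots> = 1" unfolding b'[symmetric] using det by (simp add: algebra_simps)
    finally have det': "(a + j * c) * d - b' * (c * int q) = 1" .
    have "int L dvd (a - 1) + j * c" using L by simp
    hence "int L dvd (a + j * c) - 1" by (simp add: algebra_simps)
    hence G: "stab k F (of_int (a + j * c)) (of_int b') (of_int (c * int q)) (of_int d)"
      using Gamma1_invD[OF inv det'] L by simp
    have rb: "real_of_int b + of_int j * of_int d = real q * of_int b'"
      using arg_cong[OF b', of real_of_int] by simp
    show ?thesis
      by (rule stab_mult[OF stab_translation_power[OF t, of "- j"] G])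
         (use q0 rb in \<open>auto simp: field_simps\<close>)
  qed
  show ?thesis
  proof (cases "int q dvd d")
    case False
    from nondiv[OF det L this] show ?thesis .
  next
    case True
    have "\<not> int q dvd c"
    proof
      assume "int q dvd c"
      with True have "int q dvd a * d - b * c" by simp
      with det q show False by auto
    qed
    hence nd: "\<not> int q dvd d + c" using True by (simp add: dvd_add_right_iff)
    have "int L dvd (d - 1) + c" using L by simp
    hence L': "int L dvd (d + c) - 1" by (simp add: algebra_simps)
    have "stab k F (of_int a) (of_int (b + a) / real q) (of_int c * real q) (of_int (d + c))"
      by (rule nondiv[OF _ L(1,2) L' nd]) (use det in \<open>simp add: algebra_simps\<close>)
    from stab_mult[OF this stab_inverse[OF t]] q0 show ?thesis
      by (simp add: field_simps)
  qed
qed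

lemma coprime_unit_exists:
  assumes "coprime q L" "q \<ge> 1" "L \<ge> 1"
  obtains x :: int where "int L dvd int q * x - 1"
proof -
  from assms have "coprime (int q) (int L)" by simp
  then obtain x where "[int q * x = 1] (mod int L)" using cong_solve_coprime_int by blast
  thus thesis using that by (auto simp: cong_iff_dvd_diff)
qed

definition mform :: "nat \<Rightarrow> nat \<Rightarrow> (nat \<Rightarrow> complex) \<Rightarrow> (complex \<Rightarrow> complex) \<Rightarrow> bool" where
  "mform k L b F \<longleftrightarrow> Gamma1_inv k L F \<and> qexp b F \<and> b 0 = 0"

lemma stab_translation_sq:
  assumes inv: "Gamma1_inv k L F" and q: "prime q" "\<not> q dvd L" and L1: "L \<ge> 1"
    and t: "stab k F 1 (1 / real q) 0 1"
  shows "stab k F 1 (1 / real q ^ 2) 0 1"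
proof -
  have q0: "real q > 0" using q prime_gt_0_nat by simp
  have "coprime q L" using q by (simp add: prime_imp_coprime)
  moreover have "q \<ge> 1" using q prime_ge_1_nat by blast
  ultimately obtain x where x: "int L dvd int q * x - 1" using coprime_unit_exists L1 by blast
  define \<alpha> where "\<alpha> = int q * x"
  have "int L dvd (\<alpha> - 1) * (\<alpha> + 1)" using x by (simp add: \<alpha>_def)
  then obtain \<beta> where \<beta>: "(\<alpha> - 1) * (\<alpha> + 1) = int L * \<beta>" by blast
  have A: "stab k F (of_int \<alpha>) (of_int \<beta> / real q) (of_int (int L) * real q) (of_int \<alpha>)"
    by (rule stab_conjugate[OF inv q(1) t])
       (use x \<beta> in \<open>auto simp: \<alpha>_def algebra_simps\<close>)
  define l where "l = int L"
  have G: "stab k F (of_int (1 + x * l)) (of_int (x * x)) (of_int (- l * l)) (of_int (1 - x * l))"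
    by (rule Gamma1_invD[OF inv _ _ _ _ refl refl refl refl])
       (auto simp: l_def algebra_simps)
  have r\<alpha>: "real_of_int \<alpha> = real q * of_int x" by (simp add: \<alpha>_def)
  have r\<beta>: "real_of_int \<alpha> * of_int \<alpha> - 1 = of_int l * of_int \<beta>"
    using arg_cong[OF \<beta>, of real_of_int] by (simp add: l_def algebra_simps)
  have r\<beta>': "real_of_int x * (real_of_int x * (real q * real q)) = 1 + of_int \<beta> * of_int l"
    using r\<beta> by (simp add: r\<alpha> algebra_simps)
  have r\<beta>'': "real_of_int x * (of_int x * (real q * (real q * (real q * real q)))) =
      real q * real q + of_int \<beta> * (of_int l * (real q * real q))"
    using arg_cong[OF r\<beta>', of "\<lambda>y. y * (real q * real q)"] by (simp add: algebra_simps)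
  note M1 = stab_mult[OF A G refl refl refl refl]
  show ?thesis
    by (rule stab_mult[OF M1 stab_inverse[OF A]])
       (use q0 r\<beta> in \<open>simp_all add: l_def[symmetric] r\<alpha> power2_eq_square field_simps\<close>,
        rule r\<beta>''[symmetric])
qed

text \<open>Infinite descent: the coefficients of \<open>F\<close> are supported on multiples of \<open>q\<close>, and \<open>z \<mapsto> F (z/q)\<close>
  satisfies the same hypotheses, since the group generated by \<open>\<Gamma>\<^sub>1(L)\<close> and the translation by
  \<open>1/q\<close> contains the conjugate of \<open>\<Gamma>\<^sub>1(L)\<close> by \<open>diag(q, 1)\<close> and the translation by \<open>1/q\<^sup>2\<close>.\<close>

lemma mform_translation_zero:
  assumes "mform k L b F" and q: "prime q" "\<not> q dvd L" and L1: "L \<ge> 1"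
    and "stab k F 1 (1 / real q) 0 1"
  shows "b n = 0"
  using assms(1,5)
proof (induction n arbitrary: b F rule: less_induct)
  case (less n)
  have q0: "q > 0" using q prime_gt_0_nat by simp
  from less.prems have inv: "Gamma1_inv k L F" and e: "qexp b F" and b0: "b 0 = 0"
    by (auto simp: mform_def)
  note t = less.prems(2)
  have supp: "b n = 0" if "\<not> q dvd n" for n
    by (rule qexp_periodic_support[OF e q0 _ that])
       (use stabD[OF t] in \<open>simp add: rslash_translation\<close>)
  show ?case
  proof (cases "q dvd n \<and> n \<noteq> 0")
    case False
    thus ?thesis using supp b0 by auto
  next
    case True
    then obtain m where m: "n = q * m" by blast
    with True have "m < n" using prime_gt_1_nat[OF q(1)] by auto
    define G where "G = (\<lambda>z. F (z / of_nat q))"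
    have Im: "Im (z / of_nat q) > 0" if "Im z > 0" for z
      using that q0 by simp
    have "qexp (\<lambda>m. b (q * m)) G"
      unfolding G_def by (rule qexp_contract[OF e q0 supp])
    moreover have "Gamma1_inv k L G"
      unfolding Gamma1_inv_def
    proof (intro allI impI)
      fix a b c d :: int
      assume *: "a * d - b * c = 1" "int L dvd c" "int L dvd a - 1" "int L dvd d - 1"
      note st = stab_conjugate[OF inv q(1) t *]
      have "rslash k (of_int a) (of_int b) (of_int c) (of_int d) G z = G z" if "Im z > 0" for z
        using stabD[OF st Im[OF that]] q0
        by (simp add: rslash_def G_def add_divide_distrib divide_divide_eq_left' mult.commute)
      moreover have "real_of_int (a * d - b * c) = 1" using * by simp
      ultimately show "stab k G (of_int a) (of_int b) (of_int c) (of_int d)"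
        by (simp add: stab_def)
    qed
    moreover have "stab k G 1 (1 / real q) 0 1"
    proof -
      have "G (z + of_real (1 / real q)) = G z" if "Im z > 0" for z
        using stabD[OF stab_translation_sq[OF inv q L1 t] Im[OF that]]
        by (simp add: rslash_translation G_def add_divide_distrib power2_eq_square)
      thus ?thesis by (simp add: stab_def rslash_def)
    qed
    ultimately show ?thesis
      using less.IH[OF \<open>m < n\<close>, of "\<lambda>m. b (q * m)" G] b0 by (simp add: mform_def m)
  qed
qed

lemma sum_periodic_shift:
  fixes g :: "nat \<Rightarrow> 'a :: ab_group_add"
  assumes "\<And>n. g (n + q) = g n"
  shows "(\<Sum>j<q. g (j + t)) = (\<Sum>j<q. g j)"
proof (induction t)
  case (Suc t)
  have "g t + (\<Sum>j<q. g (Suc j + t)) = (\<Sum>j<Suc q. g (j + t))"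
    by (subst sum.lessThan_Suc_shift) simp
  also have "\<dots> = (\<Sum>j<q. g (j + t)) + g t" using assms[of t] by (simp add: add.commute)
  finally show ?case using Suc by simp
qed simp

text \<open>The translates \<open>F|n(u/q)\<close>, \<open>u\<close> modulo \<open>q\<close>, together with \<open>F|A\<close> for a matrix \<open>A\<close> that
  moves \<open>0\<close> to \<open>\<infinity>\<close>, are permuted like the points of the projective line over the field with \<open>q\<close>
  elements. The permutation module is the trivial plus an irreducible module, so a linear
  relation with non-constant coefficients forces all translates to coincide.\<close>

lemma mform_class_zero:
  assumes mf: "mform k L b F" and q: "prime q" "\<not> q dvd L" and L1: "L \<ge> 1"
    and qa: "\<not> q dvd a" and vanish: "\<And>n. [n = a] (mod q) \<Longrightarrow> b n = 0"
  shows "b n = 0"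
proof -
  have q0: "q > 0" using q prime_gt_0_nat by simp
  from mf have inv: "Gamma1_inv k L F" and e: "qexp b F" and b0: "b 0 = 0"
    by (auto simp: mform_def)
  define \<psi> :: "nat \<Rightarrow> complex" where "\<psi> = (\<lambda>n. if [n = a] (mod q) then 1 else 0)"
  define C where "C = dft q \<psi>"
  have per: "\<psi> (n mod q) = \<psi> n" for n by (simp add: \<psi>_def cong_def)
  have "(\<lambda>n. \<psi> n * b n) = (\<lambda>_. 0)" using vanish by (auto simp: \<psi>_def)
  hence "qexp (\<lambda>_. 0) (\<lambda>z. \<Sum>u<q. C u * F (z + of_real (real u / real q)))"
    using qexp_sieve[of b F q \<psi>] e q0 per by (simp add: C_def)
  hence "(\<lambda>_. 0) sums (\<Sum>u<q. C u * F (z + of_real (real u / real q)))" if "Im z > 0" for z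
    using that by (simp add: qexp_def)
  hence rel: "(\<Sum>u<q. C u * F (z + of_real (real u / real q))) = 0" if "Im z > 0" for z
    using that sums_unique2 sums_zero by blast
  have C0: "C 0 = 1 / of_nat q"
  proof -
    have "(\<Sum>r<q. \<psi> r) = (\<Sum>r<q. if r = a mod q then 1 else 0)"
      by (intro sum.cong) (auto simp: \<psi>_def cong_def)
    thus ?thesis using q0 ee_of_nat[of 0] by (simp add: C_def dft_def del: ee_of_nat)
  qed
  have "(\<Sum>u<q. C u) = \<psi> 0"
    using dft_inversion[of q \<psi> 0] q0 per ee_of_nat[of 0] by (simp add: C_def del: ee_of_nat)
  also have "\<dots> = 0" using qa by (auto simp: \<psi>_def cong_def dvd_eq_mod_eq_0)
  finally have Csum: "(\<Sum>u<q. C u) = 0" .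
  have split0: "(\<Sum>u<q. g u) = g 0 + (\<Sum>u\<in>{1..<q}. g u)" for g :: "nat \<Rightarrow> complex"
    using q0 sum.atLeast_Suc_lessThan[of 0 q g] by (simp add: lessThan_atLeast0)

  have cop: "coprime q L" using q by (simp add: prime_imp_coprime)
  moreover have "q \<ge> 1" using q0 by simp
  ultimately obtain x where x: "int L dvd int q * x - 1" using coprime_unit_exists L1 by blast
  define l where "l = int L"
  define \<alpha> where "\<alpha> = int q * x"
  have l\<alpha>: "l dvd \<alpha> - 1" using x by (simp add: \<alpha>_def l_def)
  hence "l dvd (\<alpha> - 1) * (\<alpha> + 1)" by simp
  then obtain \<beta> where "(\<alpha> - 1) * (\<alpha> + 1) = l * \<beta>" by blast
  hence \<beta>: "\<alpha> * \<alpha> - \<beta> * l = 1" by (simp add: algebra_simps)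
  have r\<beta>: "real_of_int \<alpha> * of_int \<alpha> - of_int \<beta> * of_int l = 1"
    using arg_cong[OF \<beta>, of real_of_int] by simp
  have r\<alpha>: "real_of_int \<alpha> = real q * of_int x" by (simp add: \<alpha>_def)
  have q\<beta>: "\<not> int q dvd \<beta>"
  proof
    assume "int q dvd \<beta>"
    hence "int q dvd \<alpha> * \<alpha> - \<beta> * l" by (simp add: \<alpha>_def)
    thus False using \<beta> q(1) by auto
  qed
  have ql: "\<not> int q dvd l" using q by (simp add: l_def)
  define RA where "RA = rslash k (of_int \<alpha>) (of_int \<beta> / real q) (of_int l * real q) (of_int \<alpha>)"
  have detA: "real_of_int \<alpha> * of_int \<alpha> - of_int \<beta> / real q * (of_int l * real q) = 1"
    using r\<beta> q0 by simp
  define Finf where "Finf = RA F"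

  have A_unit: "RA (\<lambda>z. F (z + of_real (real u / real q))) z = F (z + of_real (real t / real q))"
    if "int q dvd l * int u * int t - \<beta>" "Im z > 0" for u t z
  proof -
    define U T where "U = int u" and "T = int t"
    have "int q dvd - (l * U * T - \<beta>) + \<alpha> * (U - T)" 
      using that(1) by (intro dvd_add) (auto simp only: dvd_minus_iff \<alpha>_def U_def T_def mult.assoc dvd_triv_left)
    then obtain b' where b': "- (l * U * T - \<beta>) + \<alpha> * (U - T) = int q * b'" by blast
    have rb': "- (real_of_int l * of_int U * of_int T - of_int \<beta>) + of_int \<alpha> * (of_int U - of_int T) = real q * of_int b'"
      using arg_cong[OF b', of real_of_int] by simp
    have st: "stab k F (of_int (\<alpha> + U * l)) (of_int b') (of_int (l * int q)) (of_int (\<alpha> - T * l))"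
    proof (rule Gamma1_invD[OF inv _ _ _ _ refl refl refl refl])
      have "(\<alpha> + U * l) * (\<alpha> - T * l) - b' * (l * int q) = (\<alpha> + U * l) * (\<alpha> - T * l) - l * (int q * b')"
        by (simp add: algebra_simps)
      also have "\<dots> = \<alpha> * \<alpha> - \<beta> * l" unfolding b'[symmetric] by (simp add: algebra_simps)
      finally show "(\<alpha> + U * l) * (\<alpha> - T * l) - b' * (l * int q) = 1" using \<beta> by simp
      have "int L dvd (\<alpha> - 1) + U * l" "int L dvd (\<alpha> - 1) - T * l" using l\<alpha> by (auto simp: l_def)
      thus "int L dvd \<alpha> + U * l - 1" "int L dvd \<alpha> - T * l - 1" by (auto simp: algebra_simps)
    qed (simp add: l_def)
    have "RA (\<lambda>z. F (z + of_real (real u / real q))) z = RA (rslash k 1 (of_int U / real q) 0 1 F) z"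
      by (simp add: rslash_translation[abs_def] U_def)
    also have "\<dots> = rslash k (of_int \<alpha> + of_int U / real q * (of_int l * real q))
        (of_int \<beta> / real q + of_int U / real q * of_int \<alpha>) (of_int l * real q) (of_int \<alpha>) F z"
      unfolding RA_def by (subst rslash_comp[OF _ detA that(2)]) simp_all
    also have "\<dots> = rslash k 1 (of_int T / real q) 0 1 F z"
      by (rule rslash_stab_left[OF st]) (use that(2) rb' q0 in \<open>auto simp: field_simps\<close>)
    finally show ?thesis by (simp add: rslash_translation T_def)
  qed
  have A_inf: "RA Finf z = F z" if "Im z > 0" for z
  proof -
    have "stab k F (of_int (2 * \<alpha> * \<alpha> - 1)) (of_int (2 * x * \<beta>)) (of_int (2 * \<alpha> * l * int q)) (of_int (2 * \<alpha> * \<alpha> - 1))"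
    proof (rule Gamma1_invD[OF inv _ _ _ _ refl refl refl refl])
      have "(2 * \<alpha> * \<alpha> - 1) * (2 * \<alpha> * \<alpha> - 1) - 2 * x * \<beta> * (2 * \<alpha> * l * int q) =
         1 + 4 * \<alpha> * \<alpha> * (\<alpha> * \<alpha> - \<beta> * l - 1)"
        unfolding \<alpha>_def by (simp add: algebra_simps)
      thus "(2 * \<alpha> * \<alpha> - 1) * (2 * \<alpha> * \<alpha> - 1) - 2 * x * \<beta> * (2 * \<alpha> * l * int q) = 1"
        using \<beta> by simp
      have "2 * \<alpha> * \<alpha> - 1 - 1 = (\<alpha> - 1) * (2 * (\<alpha> + 1))" by (simp add: algebra_simps)
      thus "int L dvd 2 * \<alpha> * \<alpha> - 1 - 1" "int L dvd 2 * \<alpha> * \<alpha> - 1 - 1" using l\<alpha> by (auto simp: l_def)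
    qed (simp add: l_def)
    from stabD[OF this that]
    have st: "rslash k (of_int (2 * \<alpha> * \<alpha> - 1)) (of_int (2 * x * \<beta>)) (of_int (2 * \<alpha> * l * int q)) (of_int (2 * \<alpha> * \<alpha> - 1)) F z = F z" .
    have "RA Finf z = rslash k (of_int \<alpha> * of_int \<alpha> + of_int \<beta> / real q * (of_int l * real q))
        (of_int \<alpha> * (of_int \<beta> / real q) + of_int \<beta> / real q * of_int \<alpha>)
        (of_int l * real q * of_int \<alpha> + of_int \<alpha> * (of_int l * real q))
        (of_int l * real q * (of_int \<beta> / real q) + of_int \<alpha> * of_int \<alpha>) F z"
      unfolding RA_def Finf_def by (rule rslash_comp[OF detA detA that])
    also have "of_int \<alpha> * of_int \<alpha> + of_int \<beta> / real q * (of_int l * real q) = of_int (2 * \<alpha> * \<alpha> - 1)"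
      using r\<beta> q0 by simp
    also have "of_int l * real q * (of_int \<beta> / real q) + of_int \<alpha> * of_int \<alpha> = of_int (2 * \<alpha> * \<alpha> - 1)"
      using r\<beta> q0 by (simp add: mult.commute)
    also have "of_int \<alpha> * (of_int \<beta> / real q) + of_int \<beta> / real q * of_int \<alpha> = of_int (2 * x * \<beta>)"
      using q0 by (simp add: r\<alpha>)
    also have "of_int l * real q * of_int \<alpha> + of_int \<alpha> * (of_int l * real q) = of_int (2 * \<alpha> * l * int q)"
      by simp
    finally show ?thesis using st by simp
  qed
  have inf_trans: "Finf (z + of_real (real j / real q)) = Finf z" if "Im z > 0" for z j
  proof -
    define J where "J = int j"
    have st: "stab k F (of_int (1 - J * \<alpha> * l)) (of_int (J * x * \<alpha>)) (of_int (- J * l * l * int q)) (of_int (1 + J * \<alpha> * l))"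
      by (rule Gamma1_invD[OF inv _ _ _ _ refl refl refl refl])
         (auto simp: \<alpha>_def l_def algebra_simps)
    have "Finf (z + of_real (real j / real q)) = rslash k 1 (of_int J / real q) 0 1 (RA F) z"
      by (simp add: rslash_translation Finf_def J_def)
    also have "\<dots> = rslash k (of_int \<alpha>) (of_int \<alpha> * (of_int J / real q) + of_int \<beta> / real q)
        (of_int l * real q) (of_int l * real q * (of_int J / real q) + of_int \<alpha>) F z"
      unfolding RA_def by (subst rslash_comp[OF detA _ that]) simp_all
    also have "\<dots> = rslash k (of_int \<alpha>) (of_int \<beta> / real q) (of_int l * real q) (of_int \<alpha>) F z"
    proof (rule rslash_stab_left[OF st detA that])
      define \<beta>' where "\<beta>' = of_int \<beta> / real q"
      have det: "real_of_int \<alpha> * of_int \<alpha> - \<beta>' * (of_int l * real q) = 1"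
        using detA by (simp only: \<beta>'_def)
      hence det: "real_of_int \<alpha> * of_int \<alpha> = 1 + \<beta>' * (of_int l * real q)" by simp
      have J\<alpha>: "real_of_int \<alpha> * (of_int J / real q) = of_int x * of_int J" using q0 by (simp add: r\<alpha>)
      show "real_of_int \<alpha> = of_int (1 - J * \<alpha> * l) * of_int \<alpha> + of_int (J * x * \<alpha>) * (of_int l * real q)"
        unfolding of_int_mult of_int_diff of_int_1 r\<alpha> by (simp add: algebra_simps)
      have "real_of_int (J * x * \<alpha>) * of_int \<alpha> = of_int J * of_int x * (real_of_int \<alpha> * of_int \<alpha>)"
        by simp
      also have "\<dots> = of_int J * of_int x + of_int J * (real q * of_int x) * of_int l * \<beta>'"
        unfolding det by (simp add: algebra_simps)
      also have "real q * of_int x = of_int \<alpha>" by (simp add: r\<alpha>)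
      finally show "real_of_int \<alpha> * (of_int J / real q) + of_int \<beta> / real q =
          of_int (1 - J * \<alpha> * l) * (of_int \<beta> / real q) + of_int (J * x * \<alpha>) * of_int \<alpha>"
        unfolding J\<alpha> \<beta>'_def[symmetric] by (simp add: algebra_simps)
      show "real_of_int l * real q = of_int (- J * l * l * int q) * of_int \<alpha> +
          of_int (1 + J * \<alpha> * l) * (of_int l * real q)"
        by (simp add: algebra_simps)
      have "of_int (1 + J * \<alpha> * l) * real_of_int \<alpha> = of_int \<alpha> + of_int J * of_int l * (real_of_int \<alpha> * of_int \<alpha>)"
        by (simp add: algebra_simps)
      also have "\<dots> = of_int \<alpha> + of_int J * of_int l + of_int J * of_int l * of_int l * real q * \<beta>'"
        unfolding det by (simp add: algebra_simps)
      finally show "of_int l * real q * (of_int J / real q) + of_int \<alpha> =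
          of_int (- J * l * l * int q) * (of_int \<beta> / real q) + of_int (1 + J * \<alpha> * l) * real_of_int \<alpha>"
        unfolding \<beta>'_def[symmetric] using q0 by (simp add: algebra_simps)
    qed
    finally show ?thesis by (simp add: Finf_def RA_def)
  qed

  have "\<exists>t\<in>{1..<q}. int q dvd l * int u * int t - \<beta>" if u: "u \<in> {1..<q}" for u
  proof -
    have "\<not> q dvd u" using u by (auto dest: dvd_imp_le)
    hence "\<not> int q dvd l * int u" using ql q(1) by (simp add: prime_dvd_mult_iff)
    hence "coprime (l * int u) (int q)" 
      using q(1) by (metis coprime_commute prime_imp_coprime prime_nat_int_transfer)
    then obtain y where y: "[l * int u * y = 1] (mod int q)" using cong_solve_coprime_int by blast
    define t where "t = nat ((y * \<beta>) mod int q)"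
    have t: "int t = (y * \<beta>) mod int q" using q0 by (simp add: t_def)
    have "[l * int u * int t = l * int u * (y * \<beta>)] (mod int q)"
      unfolding t by (intro cong_mult cong_refl) (simp add: cong_def)
    also have "l * int u * (y * \<beta>) = l * int u * y * \<beta>" by (simp add: mult_ac)
    also have "[l * int u * y * \<beta> = 1 * \<beta>] (mod int q)" using y by (intro cong_mult cong_refl)
    finally have *: "int q dvd l * int u * int t - \<beta>" by (simp add: cong_iff_dvd_diff)
    have "int t < int q" using q0 unfolding t by simp
    moreover have "t \<noteq> 0" using * q\<beta> by (intro notI) simp
    ultimately show ?thesis using * by (intro bexI[of _ t]) auto
  qed
  then obtain T where T: "\<And>u. u \<in> {1..<q} \<Longrightarrow> T u \<in> {1..<q}"
    "\<And>u. u \<in> {1..<q} \<Longrightarrow> int q dvd l * int u * int (T u) - \<beta>" by metis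
  have "inj_on T {1..<q}"
  proof (rule inj_onI)
    fix u v assume uv: "u \<in> {1..<q}" "v \<in> {1..<q}" "T u = T v"
    have "int q dvd (l * int u * int (T u) - \<beta>) - (l * int v * int (T u) - \<beta>)"
      using dvd_diff[OF T(2)[OF uv(1)] T(2)[OF uv(2)]] uv(3) by simp
    also have "\<dots> = l * int (T u) * (int u - int v)" by (simp add: algebra_simps)
    finally have "int q dvd l * int (T u) * (int u - int v)" .
    moreover have "\<not> q dvd T u" using T(1)[OF uv(1)] by (auto dest: dvd_imp_le)
    ultimately have "int q dvd int u - int v" using ql q(1) by (simp add: prime_dvd_mult_iff)
    hence "int u mod int q = int v mod int q" by (simp add: mod_eq_dvd_iff)
    thus "u = v" using uv by simp
  qed
  moreover from this have "T ` {1..<q} = {1..<q}"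
    by (rule endo_inj_surj[rotated 2]) (use T(1) in blast)+
  ultimately have bij: "bij_betw T {1..<q} {1..<q}" by (simp add: bij_betw_def)

  define S where "S = (\<lambda>z. \<Sum>u<q. F (z + of_real (real u / real q)))"
  have t1: "F (z + 1) = F z" if "Im z > 0" for z
  proof -
    have "stab k F 1 1 0 1" by (rule Gamma1_invD[OF inv, of 1 1 1 0]) auto
    from stabD[OF this that] show ?thesis using rslash_translation[of k 1 F z] by simp
  qed
  have shiftS: "(\<Sum>j<q. F (z + of_real (real j / real q) + of_real (real t / real q))) = S z"
    if "Im z > 0" for z t
  proof -
    define g where "g = (\<lambda>n. F (z + of_real (real n / real q)))"
    have "g (n + q) = g n" for n
      using t1[of "z + of_real (real n / real q)"] that q0
      by (simp add: g_def add_divide_distrib add.assoc)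
    from sum_periodic_shift[of g q t, OF this] show ?thesis
      by (simp add: g_def S_def add_divide_distrib add.assoc)
  qed
  have apply_A: "RA (\<lambda>z. \<Sum>u<q. c u * F (z + of_real (real u / real q))) z =
      c 0 * Finf z + (\<Sum>u\<in>{1..<q}. c u * F (z + of_real (real (T u) / real q)))"
    if "Im z > 0" for c z
  proof -
    have "RA (\<lambda>z. \<Sum>u<q. c u * F (z + of_real (real u / real q))) z =
        (\<Sum>u<q. c u * RA (\<lambda>z. F (z + of_real (real u / real q))) z)"
      unfolding RA_def by (rule rslash_sum)
    thus ?thesis using A_unit[OF T(2) that] by (simp add: split0 Finf_def)
  qed
  have rel_A: "C 0 * Finf z + (\<Sum>u\<in>{1..<q}. C u * F (z + of_real (real (T u) / real q))) = 0"
    if "Im z > 0" for z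
  proof -
    have "RA (\<lambda>z. \<Sum>u<q. C u * F (z + of_real (real u / real q))) z = RA (\<lambda>_. 0) z"
      unfolding RA_def by (rule rslash_cong[OF detA that]) (rule rel)
    thus ?thesis unfolding apply_A[OF that] by (simp add: RA_def rslash_def)
  qed
  have S_eq: "S z = of_nat q * Finf z" if z: "Im z > 0" for z
  proof -
    have "0 = (\<Sum>j<q. C 0 * Finf (z + of_real (real j / real q)) +
       (\<Sum>u\<in>{1..<q}. C u * F (z + of_real (real j / real q) + of_real (real (T u) / real q))))"
      using rel_A z by simp
    also have "\<dots> = of_nat q * (C 0 * Finf z) +
       (\<Sum>u\<in>{1..<q}. C u * (\<Sum>j<q. F (z + of_real (real j / real q) + of_real (real (T u) / real q))))"
      using inf_trans[OF z] by (simp add: sum.distrib sum_distrib_left sum.swap[of _ "{..<q}"])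
    also have "\<dots> = Finf z + (\<Sum>u\<in>{1..<q}. C u) * S z"
      unfolding shiftS[OF z] using q0 by (simp add: C0 sum_distrib_right)
    also have "(\<Sum>u\<in>{1..<q}. C u) = - (1 / of_nat q)"
      using Csum C0 by (simp add: split0 eq_neg_iff_add_eq_0 add.commute)
    finally show ?thesis using q0 by (simp add: field_simps)
  qed
  have F_eq: "Finf z = F z" if z: "Im z > 0" for z
  proof -
    have "RA (\<lambda>z. \<Sum>u<q. 1 * F (z + of_real (real u / real q))) z = RA (\<lambda>z. of_nat q * Finf z) z"
      unfolding RA_def by (rule rslash_cong[OF detA z]) (use S_eq in \<open>simp add: S_def\<close>)
    also have "\<dots> = of_nat q * RA Finf z" by (simp add: RA_def rslash_def)
    also have "\<dots> = of_nat q * F z" using A_inf[OF z] by simp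
    finally have "Finf z + (\<Sum>u\<in>{1..<q}. F (z + of_real (real (T u) / real q))) = of_nat q * F z"
      unfolding apply_A[OF z] by simp
    also have "(\<Sum>u\<in>{1..<q}. F (z + of_real (real (T u) / real q))) = (\<Sum>t\<in>{1..<q}. F (z + of_real (real t / real q)))"
      by (rule sum.reindex_bij_betw[OF bij])
    also have "\<dots> = S z - F z" by (simp add: S_def split0)
    finally have "(1 + of_nat q) * Finf z = (1 + of_nat q) * F z"
      using S_eq[OF z] by (simp add: algebra_simps)
    moreover have "1 + of_nat q \<noteq> (0 :: complex)" by (metis of_nat_Suc of_nat_neq_0)
    ultimately show ?thesis by simp
  qed
  have "F (z + of_real (1 / real q)) = F z" if z: "Im z > 0" for z
    using inf_trans[OF z, of 1] F_eq[OF z] F_eq[of "z + of_real (1 / real q)"] z by simp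
  hence "stab k F 1 (1 / real q) 0 1" by (simp add: stab_def rslash_translation)
  from mform_translation_zero[OF mf q L1 this] show ?thesis .
qed

lemma mform_sieve:
  assumes mf: "mform k L b F" and Q: "Q \<ge> 1" and per: "\<And>n. \<psi> (n mod Q) = \<psi> n"
  shows "mform k (L * Q ^ 2) (\<lambda>n. \<psi> n * b n)
    (\<lambda>z. \<Sum>u<Q. dft Q \<psi> u * F (z + of_real (real u / real Q)))"
proof -
  from mf have inv: "Gamma1_inv k L F" and e: "qexp b F" and b0: "b 0 = 0"
    by (auto simp: mform_def)
  have "Gamma1_inv k (L * Q ^ 2) (\<lambda>z. \<Sum>u<Q. dft Q \<psi> u * F (z + of_real (real u / real Q)))"
    unfolding Gamma1_inv_def
  proof (intro allI impI)
    fix a b c d :: int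
    assume det: "a * d - b * c = 1" and dv: "int (L * Q ^ 2) dvd c" "int (L * Q ^ 2) dvd a - 1"
      "int (L * Q ^ 2) dvd d - 1"
    have det': "real_of_int a * of_int d - of_int b * of_int c = 1"
      using arg_cong[OF det, of real_of_int] by simp
    from dv obtain c' a' d' where c': "c = int L * int Q * int Q * c'"
      and a': "a = 1 + int L * int Q * int Q * a'" and d': "d = 1 + int L * int Q * int Q * d'"
      by (auto simp: dvd_def power2_eq_square algebra_simps eq_diff_eq diff_eq_eq mult.assoc)
    have tr: "rslash k (of_int a) (of_int b) (of_int c) (of_int d) (\<lambda>z. F (z + of_real (real u / real Q))) z
        = F (z + of_real (real u / real Q))" if z: "Im z > 0" for u z
    proof -
      define U where "U = int u"
      define l where "l = int L"
      define Q' where "Q' = int Q"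
      define B where "B = b + (d' - a') * l * Q' * U - l * c' * U * U"
      have st: "stab k F (of_int (a + l * Q' * c' * U)) (of_int B) (of_int c) (of_int (d - l * Q' * c' * U))"
      proof (rule Gamma1_invD[OF inv _ _ _ _ refl refl refl refl])
        show "(a + l * Q' * c' * U) * (d - l * Q' * c' * U) - B * c = 1"
          using det unfolding B_def c' a' d' l_def[symmetric] Q'_def[symmetric] by (simp add: algebra_simps)
      qed (auto simp: a' c' d' l_def algebra_simps)
      have "rslash k (of_int a) (of_int b) (of_int c) (of_int d) (\<lambda>z. F (z + of_real (real u / real Q))) z =
         rslash k (of_int a) (of_int b) (of_int c) (of_int d) (rslash k 1 (of_int U / real Q) 0 1 F) z"
        by (simp add: rslash_translation[abs_def] U_def)
      also have "\<dots> = rslash k (of_int a + of_int U / real Q * of_int c) (of_int b + of_int U / real Q * of_int d)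
          (of_int c) (of_int d) F z"
        by (subst rslash_comp[OF _ det' z]) simp_all
      also have "\<dots> = rslash k 1 (of_int U / real Q) 0 1 F z"
        by (rule rslash_stab_left[OF st _ z])
           (use Q in \<open>simp_all add: B_def c' a' d' l_def Q'_def field_simps\<close>)
      finally show ?thesis by (simp add: rslash_translation U_def)
    qed
    show "stab k (\<lambda>z. \<Sum>u<Q. dft Q \<psi> u * F (z + of_real (real u / real Q)))
        (of_int a) (of_int b) (of_int c) (of_int d)"
      unfolding stab_def rslash_sum using det' tr by simp
  qed
  thus ?thesis using qexp_sieve[of b F Q \<psi>] e Q per b0 by (simp add: mform_def)
qed

lemma mform_classes_zero:
  assumes "finite A" "mform k L b F" "L \<ge> 1"
    and "\<And>q. q \<in> A \<Longrightarrow> prime q \<and> \<not> q dvd L \<and> \<not> q dvd a"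
    and "\<And>n. (\<And>q. q \<in> A \<Longrightarrow> [n = a] (mod q)) \<Longrightarrow> b n = 0"
  shows "b n = 0"
  using assms
proof (induction A arbitrary: L b F n rule: finite_induct)
  case empty
  thus ?case by simp
next
  case (insert q A)
  have q: "prime q" "\<not> q dvd L" "\<not> q dvd a" using insert.prems(3) by auto
  have q1: "q \<ge> 1" using q prime_ge_1_nat by blast
  define \<psi> :: "nat \<Rightarrow> complex" where "\<psi> = (\<lambda>n. if [n = a] (mod q) then 1 else 0)"
  have mf: "mform k (L * q ^ 2) (\<lambda>n. \<psi> n * b n)
    (\<lambda>z. \<Sum>u<q. dft q \<psi> u * F (z + of_real (real u / real q)))"
    by (rule mform_sieve[OF insert.prems(1) q1]) (simp add: \<psi>_def cong_def)
  have "\<psi> n * b n = 0" for n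
  proof (rule insert.IH[OF mf])
    show "L * q ^ 2 \<ge> 1" using q1 insert.prems(2) by simp
    show "prime r \<and> \<not> r dvd L * q ^ 2 \<and> \<not> r dvd a" if "r \<in> A" for r
    proof -
      have r: "prime r" "\<not> r dvd L" "\<not> r dvd a" using insert.prems(3) that by auto
      have "\<not> r dvd q" using r(1) q(1) insert.hyps that primes_dvd_imp_eq by blast
      thus ?thesis using r by (simp add: prime_dvd_mult_iff prime_dvd_power_iff)
    qed
    show "\<psi> n * b n = 0" if "\<And>r. r \<in> A \<Longrightarrow> [n = a] (mod r)" for n
      using that insert.prems(4)[of n] by (auto simp: \<psi>_def)
  qed
  hence "b n = 0" if "[n = a] (mod q)" for n
    using that by (metis \<psi>_def mult_cancel_right2 mult_eq_0_iff)
  from mform_class_zero[OF insert.prems(1) q(1,2) insert.prems(2) q(3) this] show ?case .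
qed

subsection \<open>Hecke relations\<close>

lemma power_cong_1_exists:
  fixes n N :: nat
  assumes "coprime n N" "N \<ge> 1"
  shows "\<exists>j>0. [n ^ j = 1] (mod N)"
proof -
  have "range (\<lambda>i. n ^ i mod N) \<subseteq> {..<N}" using assms(2) by auto
  hence "finite (range (\<lambda>i. n ^ i mod N))" using finite_subset by blast
  hence "\<not> inj (\<lambda>i. n ^ i mod N)" using finite_imageD infinite_UNIV_nat by blast
  then obtain i i' where "i < i'" "n ^ i mod N = n ^ i' mod N"
    unfolding inj_def by (metis nat_neq_iff)
  hence "[n ^ i * n ^ (i' - i) = n ^ i * 1] (mod N)"
    by (simp add: cong_def power_add[symmetric])
  hence "[n ^ (i' - i) = 1] (mod N)"
    using assms(1) cong_mult_lcancel_nat[of "n ^ i" N "n ^ (i' - i)" 1] by simp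
  thus ?thesis using \<open>i < i'\<close> by (intro exI[of _ "i' - i"]) auto
qed


lemma slash_eq_rslash:
  "Im z > 0 \<Longrightarrow> slash k A f z =
     rslash k (of_int (A $ 1 $ 1)) (of_int (A $ 1 $ 2)) (of_int (A $ 2 $ 1)) (of_int (A $ 2 $ 2)) f z"
  by (simp add: slash_def rslash_def upper_half_plane_def)

lemma cusp_form_Gamma1_inv:
  assumes "f \<in> cusp_forms k N"
  shows "Gamma1_inv k N f"
  unfolding Gamma1_inv_def
proof (intro allI impI)
  fix a b c d :: int
  assume *: "a * d - b * c = 1" "int N dvd c" "int N dvd a - 1" "int N dvd d - 1"
  define A :: "int^2^2" where "A = vector [vector [a, b], vector [c, d]]"
  have "A \<in> Gamma1 N"
    using * by (simp add: Gamma1_def SL2Z_def A_def det_2 cong_iff_dvd_diff)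
  hence "slash k A f = f" using assms by (simp add: cusp_forms_def)
  moreover have "real_of_int (a * d - b * c) = 1" using * by simp
  ultimately show "stab k f (of_int a) (of_int b) (of_int c) (of_int d)"
    using slash_eq_rslash[of _ k A f] by (simp add: stab_def A_def)
qed

lemma cusp_form_mform:
  assumes f: "f \<in> cusp_forms k N" and N: "N \<ge> 1"
  shows "mform k N (fourier_coeff f) f"
proof -
  have inv: "Gamma1_inv k N f" by (rule cusp_form_Gamma1_inv) fact
  have N0: "N > 0" using N by simp
  have "(mat 1 :: int^2^2) \<in> SL2Z" by (simp add: SL2Z_def)
  then obtain c where c0: "c 0 = 0"
    and c: "\<And>z. z \<in> upper_half_plane \<Longrightarrow>
      (\<lambda>n. c n * exp (2 * of_real pi * \<i> * of_nat n * z / of_nat N)) sums slash k (mat 1) f z"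
    using f unfolding cusp_forms_def by blast
  have c': "(\<lambda>n. c n * ee (of_nat n * (z / of_nat N))) sums f z" if "Im z > 0" for z
    using c[of z] that by (simp add: upper_half_plane_def slash_def ee_def mat_def mult.assoc)
  define F where "F = (\<lambda>z. f (of_nat N * z))"
  have F: "qexp c F" using c'[of "of_nat N * _"] N by (simp add: qexp_def F_def)
  have t1: "f (z + 1) = f z" if "Im z > 0" for z
  proof -
    have "stab k f 1 1 0 1" by (rule Gamma1_invD[OF inv, of 1 1 1 0]) auto
    from stabD[OF this that] show ?thesis using rslash_translation[of k 1 f z] by simp
  qed
  have supp: "c n = 0" if "\<not> N dvd n" for n
    by (rule qexp_periodic_support[OF F N0 _ that])
       (use t1[of "of_nat N * _"] N in \<open>simp add: F_def distrib_left\<close>)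
  have e: "qexp (\<lambda>m. c (N * m)) f"
    using qexp_contract[OF F N0 supp] N by (simp add: F_def)
  have "fourier_coeff f = (THE c. qexp c f)"
    by (simp add: fourier_coeff_def qexp_def ee_def upper_half_plane_def mult.assoc)
  also have "\<dots> = (\<lambda>m. c (N * m))"
    using e qexp_unique by (intro the_equality) auto
  finally show ?thesis using e inv c0 by (simp add: mform_def)
qed

lemma Gamma0_elem_exists:
  assumes "coprime d N"
  obtains A :: "int^2^2" where "A \<in> Gamma0 N" "[A $ 2 $ 2 = int d] (mod int N)"
proof -
  have "coprime (int d) (int N)" using assms by simp
  then obtain a where "[int d * a = 1] (mod int N)" using cong_solve_coprime_int by blast
  then obtain b where "int d * a - 1 = int N * b" by (auto simp: cong_iff_dvd_diff)
  hence "(vector [vector [a, b], vector [int N, int d]] :: int^2^2) \<in> Gamma0 N"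
    by (simp add: Gamma0_def SL2Z_def det_2 cong_0_iff algebra_simps)
  thus thesis by (rule that) simp
qed

lemma diamond_witness:
  assumes "coprime d N"
  obtains A :: "int^2^2" where "diamond k N d f = slash k A f" "A \<in> Gamma0 N" "[A $ 2 $ 2 = int d] (mod int N)"
proof -
  define A where "A = (SOME A :: int^2^2. A \<in> Gamma0 N \<and> [A $ 2 $ 2 = int d] (mod int N))"
  have "\<exists>A :: int^2^2. A \<in> Gamma0 N \<and> [A $ 2 $ 2 = int d] (mod int N)"
    using Gamma0_elem_exists[OF assms] by metis
  from someI_ex[OF this] have "A \<in> Gamma0 N \<and> [A $ 2 $ 2 = int d] (mod int N)"
    unfolding A_def .
  thus thesis using that[of A] by (simp add: diamond_def A_def)
qed

lemma dvd_minus_one_of_det: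
  fixes a b c d n :: int
  assumes "a * d - b * c = 1" "n dvd c" "n dvd d - 1"
  shows "n dvd a - 1"
proof -
  have "a - 1 = b * c - a * (d - 1)" using assms(1) by (simp add: algebra_simps)
  thus ?thesis using assms by simp
qed

lemma diamond_one:
  assumes "f \<in> cusp_forms k N"
  shows "diamond k N 1 f = f"
proof -
  obtain A :: "int^2^2" where A: "diamond k N 1 f = slash k A f" "A \<in> Gamma0 N" "[A $ 2 $ 2 = int 1] (mod int N)"
    by (rule diamond_witness[of 1 N k f]) simp
  have "int N dvd A $ 1 $ 1 - 1"
    by (rule dvd_minus_one_of_det[of _ "A $ 2 $ 2" "A $ 1 $ 2" "A $ 2 $ 1"])
       (use A in \<open>auto simp: Gamma0_def SL2Z_def det_2 cong_0_iff cong_iff_dvd_diff\<close>)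
  hence "A \<in> Gamma1 N"
    using A by (auto simp: Gamma0_def Gamma1_def cong_iff_dvd_diff)
  thus ?thesis using A assms by (simp add: cusp_forms_def)
qed

lemma diamond_eigenvalue_root_of_unity:
  assumes f: "f \<in> cusp_forms k N" "f \<noteq> (\<lambda>_. 0)" and N: "N \<ge> 1" and cop: "coprime n N"
    and eig: "diamond k N n f = (\<lambda>z. \<epsilon> * f z)"
  shows "\<exists>j>0. \<epsilon> ^ j = 1"
proof -
  obtain A :: "int^2^2" where A: "diamond k N n f = slash k A f" "A \<in> Gamma0 N" "[A $ 2 $ 2 = int n] (mod int N)"
    by (rule diamond_witness[OF cop])
  define a b c d where "a = A $ 1 $ 1" and "b = A $ 1 $ 2" and "c = A $ 2 $ 1" and "d = A $ 2 $ 2"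
  have det: "a * d - b * c = 1" and Nc: "int N dvd c" and dn: "[d = int n] (mod int N)"
    using A by (auto simp: Gamma0_def SL2Z_def det_2 a_def b_def c_def d_def cong_0_iff)
  have rdet: "real_of_int a * of_int d - of_int b * of_int c = 1"
    using arg_cong[OF det, of real_of_int] by simp
  have eigA: "rslash k (of_int a) (of_int b) (of_int c) (of_int d) f z = \<epsilon> * f z" if "Im z > 0" for z
    using slash_eq_rslash[OF that, of k A f] fun_cong[OF A(1)[symmetric, unfolded eig], of z]
    by (simp add: a_def b_def c_def d_def)
  have pow: "\<exists>a' b' c' d' :: int. a' * d' - b' * c' = 1 \<and> int N dvd c' \<and> [d' = d ^ j] (mod int N) \<and>
     (\<forall>z. Im z > 0 \<longrightarrow> rslash k (of_int a') (of_int b') (of_int c') (of_int d') f z = \<epsilon> ^ j * f z)" for j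
  proof (induction j)
    case 0
    show ?case by (rule exI[of _ 1], rule exI[of _ 0], rule exI[of _ 0], rule exI[of _ 1]) (simp add: rslash_def)
  next
    case (Suc j)
    then obtain a' b' c' d' :: int where *: "a' * d' - b' * c' = 1" "int N dvd c'" "[d' = d ^ j] (mod int N)"
      and r: "\<And>z. Im z > 0 \<Longrightarrow> rslash k (of_int a') (of_int b') (of_int c') (of_int d') f z = \<epsilon> ^ j * f z"
      by blast
    have rdet': "real_of_int a' * of_int d' - of_int b' * of_int c' = 1"
      using arg_cong[OF *(1), of real_of_int] by simp
    have "(a' * a + b' * c) * (c' * b + d' * d) - (a' * b + b' * d) * (c' * a + d' * c) =
       (a' * d' - b' * c') * (a * d - b * c)" by (simp add: algebra_simps)
    hence 1: "(a' * a + b' * c) * (c' * b + d' * d) - (a' * b + b' * d) * (c' * a + d' * c) = 1"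
      using * det by simp
    have 2: "int N dvd c' * a + d' * c" using * Nc by simp
    have "[c' * b + d' * d = 0 * b + d ^ j * d] (mod int N)"
      using * by (intro cong_add cong_mult cong_refl) (auto simp: cong_0_iff)
    hence 3: "[c' * b + d' * d = d ^ Suc j] (mod int N)" by (simp add: mult.commute)
    have 4: "rslash k (of_int (a' * a + b' * c)) (of_int (a' * b + b' * d)) (of_int (c' * a + d' * c)) (of_int (c' * b + d' * d)) f z
       = \<epsilon> ^ Suc j * f z" if z: "Im z > 0" for z
    proof -
      have "rslash k (of_int (a' * a + b' * c)) (of_int (a' * b + b' * d)) (of_int (c' * a + d' * c)) (of_int (c' * b + d' * d)) f z
         = rslash k (of_int a) (of_int b) (of_int c) (of_int d) (rslash k (of_int a') (of_int b') (of_int c') (of_int d') f) z"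
        by (subst rslash_comp[OF rdet' rdet z]) simp
      also have "\<dots> = rslash k (of_int a) (of_int b) (of_int c) (of_int d) (\<lambda>z. \<epsilon> ^ j * f z) z"
        by (rule rslash_cong[OF rdet z r])
      also have "\<dots> = \<epsilon> ^ j * rslash k (of_int a) (of_int b) (of_int c) (of_int d) f z"
        by (simp add: rslash_def)
      finally show ?thesis using eigA[OF z] by simp
    qed
    from 1 2 3 4 show ?case by blast
  qed
  obtain j where j: "j > 0" "[n ^ j = 1] (mod N)"
    using power_cong_1_exists[OF cop N] by blast
  from pow[of j] obtain a' b' c' d' :: int where *: "a' * d' - b' * c' = 1" "int N dvd c'" "[d' = d ^ j] (mod int N)"
      and r: "\<And>z. Im z > 0 \<Longrightarrow> rslash k (of_int a') (of_int b') (of_int c') (of_int d') f z = \<epsilon> ^ j * f z"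
    by blast
  from j have "[int (n ^ j) = int 1] (mod int N)" by (simp only: cong_int_iff)
  hence "[int n ^ j = 1] (mod int N)" by simp
  with *(3) cong_pow[OF dn, of j] have "[d' = 1] (mod int N)" by (meson cong_trans)
  hence d1: "int N dvd d' - 1" by (simp add: cong_iff_dvd_diff)
  have st: "stab k f (of_int a') (of_int b') (of_int c') (of_int d')"
    by (rule Gamma1_invD[OF cusp_form_Gamma1_inv[OF f(1)] *(1,2) _ d1])
       (use dvd_minus_one_of_det[OF *(1,2) d1] in auto)
  from f(2) obtain z where z: "f z \<noteq> 0" by auto
  hence "Im z > 0" using f(1) by (auto simp: cusp_forms_def upper_half_plane_def)
  from stabD[OF st this] r[OF this] z have "\<epsilon> ^ j = 1" by simp
  thus ?thesis using j by blast
qed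

lemma hecke_relation:
  assumes ef: "cuspidal_eigenform k N f" and nf: "normalised f" and N: "N \<ge> 1" and q: "prime q"
  obtains \<epsilon> where "\<exists>j>0. \<epsilon> ^ j = 1"
    and "\<And>m. fourier_coeff f q * fourier_coeff f m = fourier_coeff f (q * m) +
      (if q dvd m \<and> \<not> q dvd N then \<epsilon> * of_nat q powi (int k - 1) * fourier_coeff f (m div q) else 0)"
proof -
  have q0: "q > 0" using q prime_gt_0_nat by blast
  have q1: "q \<noteq> 1" using q by auto
  from ef have f: "f \<in> cusp_forms k N" "f \<noteq> (\<lambda>_. 0)" by (auto simp: cuspidal_eigenform_def)
  define a where "a = fourier_coeff f"
  have e: "qexp a f" using cusp_form_mform[OF f(1) N] by (simp add: mform_def a_def)
  have "\<forall>n\<ge>1. \<exists>c. hecke k N n f = (\<lambda>z. c * f z)"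
    using ef unfolding cuspidal_eigenform_def by blast
  then obtain c where c: "hecke k N q f = (\<lambda>z. c * f z)" using q0 by (auto simp: Suc_le_eq)
  have cop: "coprime q N" if "\<not> q dvd N" using that q by (simp add: prime_imp_coprime)
  obtain \<epsilon> where \<epsilon>: "\<exists>j>0. \<epsilon> ^ j = 1" "\<not> q dvd N \<Longrightarrow> diamond k N q f = (\<lambda>z. \<epsilon> * f z)"
  proof (cases "q dvd N")
    case True
    show ?thesis by (rule that[of 1]) (use True in auto)
  next
    case False
    have "\<forall>d. coprime d N \<longrightarrow> (\<exists>c. diamond k N d f = (\<lambda>z. c * f z))"
      using ef unfolding cuspidal_eigenform_def by blast
    then obtain \<epsilon> where "diamond k N q f = (\<lambda>z. \<epsilon> * f z)" using cop[OF False] by blast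
    thus ?thesis using diamond_eigenvalue_root_of_unity[OF f N cop[OF False]] that by blast
  qed
  define Q :: complex where "Q = of_nat q powi (int k - 1)"
  have Qk: "Q / of_nat q ^ k = (1 / of_nat q :: complex)"
    unfolding Q_def using q0 by (simp add: power_int_diff)
  have set: "{a. a dvd q \<and> coprime a N} = (if q dvd N then {1} else {1, q})"
  proof -
    have "\<not> coprime q N" if "q dvd N" using that q1 by (simp add: coprime_absorb_left)
    moreover have "a = 1 \<or> a = q" if "a dvd q" for a using that q by (simp add: prime_nat_iff)
    ultimately show ?thesis using cop by auto
  qed
  define w where "w = (if q dvd N then 0 else \<epsilon> * Q)"
  have H: "hecke k N q f z = (\<Sum>u<q. f ((z + of_nat u) / of_nat q)) / of_nat q + w * f (of_nat q * z)" for z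
  proof -
    have "hecke k N q f z = Q * (\<Sum>u<q. f ((z + of_nat u) / of_nat q) / of_nat q ^ k) + w * f (of_nat q * z)"
      unfolding hecke_def set Q_def[symmetric]
      using q0 q1 \<epsilon>(2) by (simp add: diamond_one[OF f(1), simplified] w_def distrib_left)
    also have "Q * (\<Sum>u<q. f ((z + of_nat u) / of_nat q) / of_nat q ^ k) =
       (Q / of_nat q ^ k) * (\<Sum>u<q. f ((z + of_nat u) / of_nat q))"
      by (simp add: sum_divide_distrib[symmetric])
    finally show ?thesis by (simp add: Qk)
  qed
  have "qexp (\<lambda>m. a (q * m) + w * (if q dvd m then a (m div q) else 0))
     (\<lambda>z. (\<Sum>u<q. f ((z + of_nat u) / of_nat q)) / of_nat q + w * f (of_nat q * z))"
    by (intro qexp_add qexp_cmult qexp_U qexp_dilate e q0)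
  hence *: "qexp (\<lambda>m. a (q * m) + w * (if q dvd m then a (m div q) else 0)) (\<lambda>z. c * f z)"
    unfolding H[symmetric] c .
  from qexp_unique[OF qexp_cmult[OF e] *]
  have rel: "c * a m = a (q * m) + w * (if q dvd m then a (m div q) else 0)" for m
    by (rule fun_cong)
  have "a 1 = 1" using nf by (simp add: normalised_def a_def)
  with rel[of 1] q1 have "c = a q" by simp
  show thesis
  proof (rule that[OF \<epsilon>(1)])
    fix m
    show "fourier_coeff f q * fourier_coeff f m = fourier_coeff f (q * m) +
      (if q dvd m \<and> \<not> q dvd N then \<epsilon> * of_nat q powi (int k - 1) * fourier_coeff f (m div q) else 0)"
      using rel[of m] unfolding \<open>c = a q\<close> by (simp add: a_def w_def Q_def)
  qed
qed

subsection \<open>Quadratic characters and vanishing coefficients\<close>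

lemma dirichlet_character_cong:
  assumes "dirichlet_character D \<phi>" "[a = b] (mod D)"
  shows "\<phi> a = \<phi> b"
proof -
  have "\<phi> (a + n * D) = \<phi> a" for a n
  proof (induction n)
    case (Suc n)
    have "\<phi> (a + n * D + D) = \<phi> (a + n * D)" using assms(1) by (simp add: dirichlet_character_def)
    thus ?case using Suc by (simp add: add_ac)
  qed simp
  hence mod: "\<phi> (a mod D) = \<phi> a" for a by (metis mod_mult_div_eq mult.commute)
  show ?thesis using mod[of a] mod[of b] assms(2) by (simp add: cong_def)
qed

lemma dirichlet_character_power:
  assumes "dirichlet_character D \<phi>"
  shows "\<phi> (a ^ n) = \<phi> a ^ n"
  using assms by (induction n) (auto simp: dirichlet_character_def)

lemma quadratic_character_values:
  assumes "nontrivial_quadratic_character D \<phi>" "coprime a D"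
  shows "\<phi> a = 1 \<or> \<phi> a = -1"
  using assms by (auto simp: nontrivial_quadratic_character_def power2_eq_1_iff)

lemma power_self_cong_1:
  fixes m :: nat
  assumes "d > 0" "\<And>q. prime q \<Longrightarrow> q dvd d \<Longrightarrow> [m = 1] (mod q)"
  shows "[m ^ d = 1] (mod d)"
  using assms
proof (induction d rule: less_induct)
  case (less d)
  show ?case
  proof (cases "d = 1")
    case False
    then obtain q where q: "prime q" "q dvd d" using prime_factor_nat by blast
    then obtain c where c: "d = q * c" by blast
    have "c < d" "c > 0" using c q less.prems(1) prime_gt_1_nat[of q] by auto
    define y where "y = int (m ^ c)"
    have "[m ^ c = 1] (mod c)" by (rule less.IH) (use \<open>c < d\<close> \<open>c > 0\<close> less.prems c in auto)
    hence "[y = 1] (mod int c)" unfolding y_def by (metis cong_int_iff of_nat_1)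
    hence 1: "int c dvd y - 1" by (simp add: cong_iff_dvd_diff)
    have "[m ^ c = 1 ^ c] (mod q)" by (intro cong_pow less.prems q)
    hence yq: "[y = 1] (mod int q)" unfolding y_def by (metis cong_int_iff of_nat_1 power_one)
    have "[(\<Sum>i<q. y ^ i) = (\<Sum>i<q. 1 ^ i)] (mod int q)"
      by (intro cong_sum cong_pow yq)
    hence "int q dvd (\<Sum>i<q. y ^ i)" by (simp add: cong_def dvd_eq_mod_eq_0)
    with 1 have "int c * int q dvd (y - 1) * (\<Sum>i<q. y ^ i)" by (rule mult_dvd_mono)
    also have "(y - 1) * (\<Sum>i<q. y ^ i) = y ^ q - 1" by (rule power_diff_1_eq[symmetric])
    also have "y ^ q = int (m ^ d)" by (simp add: y_def c power_mult[symmetric] mult.commute)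
    finally have "[int (m ^ d) = int 1] (mod int d)" by (simp add: cong_iff_dvd_diff c mult.commute)
    thus ?thesis by (simp only: cong_int_iff)
  qed simp
qed

lemma sqrt_mod_power_2:
  fixes m :: nat
  assumes "[m = 1] (mod 8)"
  shows "\<exists>w::nat. [w ^ 2 = m] (mod 2 ^ e)"
proof -
  have "\<exists>w::int. odd w \<and> [w ^ 2 = int m] (mod 2 ^ (e + 3))" for e
  proof (induction e)
    case 0
    have "[int m = int 1] (mod int 8)" using assms by (simp only: cong_int_iff)
    thus ?case by (intro exI[of _ 1]) (simp add: cong_sym_eq)
  next
    case (Suc e)
    then obtain w t where w: "odd w" "w ^ 2 - int m = 2 ^ (e + 3) * t"
      by (auto simp: cong_iff_dvd_diff elim!: dvdE)
    show ?case
    proof (cases "even t")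
      case True
      then obtain s where "t = 2 * s" by blast
      hence "w ^ 2 - int m = 2 ^ (Suc e + 3) * s" using w by (simp add: power_add)
      thus ?thesis using w by (intro exI[of _ w]) (simp add: cong_iff_dvd_diff)
    next
      case False
      hence "even (t + w)" using w by simp
      then obtain s where s: "t + w = 2 * s" by blast
      define v where "v = w + 2 ^ (e + 2)"
      have "v ^ 2 - int m = (w ^ 2 - int m) + 2 ^ (e + 3) * w + 2 ^ (e + 4) * 2 ^ e"
        by (simp add: v_def power2_eq_square power_add algebra_simps)
      also have "\<dots> = 2 ^ (e + 3) * (t + w) + 2 ^ (e + 4) * 2 ^ e"
        unfolding w(2) by (simp add: algebra_simps)
      also have "\<dots> = 2 ^ (Suc e + 3) * (s + 2 ^ e)" unfolding s by (simp add: power_add algebra_simps)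
      finally have "[v ^ 2 = int m] (mod 2 ^ (Suc e + 3))" by (simp add: cong_iff_dvd_diff)
      moreover have "odd v" using w by (simp add: v_def)
      ultimately show ?thesis by blast
    qed
  qed
  then obtain w :: int where "[w ^ 2 = int m] (mod 2 ^ (e + 3))" by blast
  hence "[w ^ 2 = int m] (mod 2 ^ e)" by (rule cong_dvd_modulus) (simp add: le_imp_power_dvd)
  hence "[int (nat \<bar>w\<bar> ^ 2) = int m] (mod int (2 ^ e))" by simp
  thus ?thesis by (metis cong_int_iff)
qed

lemma quadratic_character_eq_1:
  assumes ch: "nontrivial_quadratic_character D \<phi>" and cop: "coprime m D"
    and m8: "[m = 1] (mod 8)"
    and modd: "\<And>q. prime q \<Longrightarrow> q dvd D \<Longrightarrow> odd q \<Longrightarrow> [m = 1] (mod q)"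
  shows "\<phi> m = 1"
proof -
  have dc: "dirichlet_character D \<phi>" and D: "D > 0"
    using ch by (auto simp: nontrivial_quadratic_character_def dirichlet_character_def)
  obtain d where d: "D = 2 ^ multiplicity 2 D * d" "odd d"
    using multiplicity_decompose'[of D 2] D by auto
  define e where "e = multiplicity 2 D"
  have d0: "d > 0" using d by (cases "d = 0") auto
  have md: "[m ^ d = 1] (mod d)"
  proof (rule power_self_cong_1[OF d0])
    fix q assume q: "prime q" "q dvd d"
    have "d dvd D" by (metis d(1) dvd_triv_right)
    moreover have "odd q" using q(2) d(2) dvd_trans by blast
    ultimately show "[m = 1] (mod q)" using modd q dvd_trans by blast
  qed
  have "[m ^ d = 1 ^ d] (mod 8)" by (rule cong_pow) (rule m8)
  then obtain w where w: "[w ^ 2 = m ^ d] (mod 2 ^ e)" using sqrt_mod_power_2[of "m ^ d" e] by auto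
  have "coprime (2 ^ e) d" using d by simp
  then obtain x where x: "[x = w] (mod 2 ^ e)" "[x = 1] (mod d)"
    using binary_chinese_remainder_nat by blast
  have "[x ^ 2 = m ^ d] (mod 2 ^ e)" using cong_trans[OF cong_pow[OF x(1)] w] .
  moreover have "[x ^ 2 = m ^ d] (mod d)"
    using cong_trans[OF cong_pow[OF x(2), of 2]] md by (simp add: cong_sym_eq)
  ultimately have "[x ^ 2 = m ^ d] (mod D)"
    using \<open>coprime (2 ^ e) d\<close> d e_def by (metis coprime_cong_mult_nat)
  hence sq: "\<phi> x ^ 2 = \<phi> m ^ d"
    using dirichlet_character_cong[OF dc] dirichlet_character_power[OF dc] by metis
  have pm: "\<phi> m = 1 \<or> \<phi> m = -1" by (rule quadratic_character_values[OF ch cop])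
  hence "\<phi> x \<noteq> 0" using sq by auto
  hence "coprime x D" using dc by (auto simp: dirichlet_character_def)
  hence "\<phi> m ^ d = 1" using quadratic_character_values[OF ch] sq by fastforce
  thus ?thesis using pm d by auto
qed

lemma coprime_lift:
  fixes n E D :: nat
  assumes "coprime n E" "D > 0"
  obtains n' where "[n' = n] (mod E)" "coprime n' D" "coprime n' E"
proof -
  define A where "A = {q. prime q \<and> q dvd D \<and> \<not> q dvd E}"
  have finA: "finite A" using finite_prime_divisors[of D] assms(2) by (auto simp: A_def intro: finite_subset)
  define K where "K = \<Prod>A"
  have "coprime E K" unfolding K_def
    by (intro prod_coprime_right) (auto simp: A_def coprime_commute prime_imp_coprime)
  then obtain n' where n': "[n' = n] (mod E)" "[n' = 1] (mod K)"
    using binary_chinese_remainder_nat by blast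
  have cE: "coprime n' E" using n'(1) assms(1) by (metis cong_imp_coprime cong_sym)
  have "coprime n' D"
  proof (rule ccontr)
    assume "\<not> coprime n' D"
    then obtain q where q: "prime q" "q dvd n'" "q dvd D"
      by (metis coprime_iff_gcd_eq_1 gcd_greatest_iff prime_factor_nat)
    show False
    proof (cases "q dvd E")
      case True
      thus False using cE q not_prime_unit coprime_common_divisor by blast
    next
      case False
      hence "q \<in> A" using q by (simp add: A_def)
      hence "q dvd K" unfolding K_def using finA by (intro dvd_prodI) auto
      hence "[n' = 1] (mod q)" using n'(2) cong_dvd_modulus_nat by blast
      hence "q dvd 1" using q(2) by (metis cong_dvd_iff)
      thus False using q(1) by simp
    qed
  qed
  thus thesis using that n'(1) cE by blast
qed

lemma cm_coeff_zero:
  fixes a :: "nat \<Rightarrow> complex"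
  assumes rel: "\<And>q. prime q \<Longrightarrow> \<exists>e. \<forall>m. a q * a m = a (q * m) + (if q dvd m then e * a (m div q) else 0)"
    and ch: "nontrivial_quadratic_character D \<phi>"
    and "n > 0" "\<phi> n = -1" "\<And>q. prime q \<Longrightarrow> q dvd n \<Longrightarrow> \<not> q dvd D \<and> a q = \<phi> q * a q"
  shows "a n = 0"
  using assms(3-)
proof (induction n rule: less_induct)
  case (less n)
  have dc: "\<phi> 1 = 1" "\<phi> (x * y) = \<phi> x * \<phi> y" for x y
    using ch by (auto simp: nontrivial_quadratic_character_def dirichlet_character_def)
  have "n \<noteq> 1" using less.prems dc(1) by auto
  then obtain q where q: "prime q" "q dvd n" using prime_factor_nat by blast
  then obtain m where n: "n = q * m" by blast
  have q1: "q > 1" using q prime_gt_1_nat by blast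
  have m: "m < n" "m > 0" using n q1 less.prems(1) by auto
  have "coprime q D" using q less.prems(3) by (simp add: prime_imp_coprime)
  hence \<phi>q: "\<phi> q = 1 \<or> \<phi> q = -1" by (rule quadratic_character_values[OF ch])
  have IH: "a x = 0" if "x < n" "x dvd n" "\<phi> x = -1" for x
  proof (rule less.IH[OF that(1) _ that(3)])
    show "x > 0" using that less.prems(1) by (intro Nat.gr0I) auto
    show "\<not> r dvd D \<and> a r = \<phi> r * a r" if "prime r" "r dvd x" for r
      using less.prems(3)[OF that(1)] that \<open>x dvd n\<close> dvd_trans by blast
  qed
  obtain e where e: "a q * a m = a n + (if q dvd m then e * a (m div q) else 0)"
    using rel[OF q(1)] n by blast
  have "a q * a m = 0"
  proof (cases "\<phi> q = 1")
    case True
    hence "\<phi> m = -1" using less.prems(2) by (simp add: n dc)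
    thus ?thesis using IH[of m] m n by simp
  next
    case False
    with \<phi>q have "a q = - a q" using less.prems(3)[OF q] by auto
    thus ?thesis by (simp add: eq_neg_iff_add_eq_0)
  qed
  moreover have "a (m div q) = 0" if "q dvd m"
  proof -
    from that obtain x where x: "m = q * x" by blast
    have "\<phi> x = -1" using less.prems(2) \<phi>q by (auto simp: n x dc)
    moreover have "x \<le> q * x" using q1 by simp
    hence "x < n" using m x by linarith
    ultimately show ?thesis using IH[of x] n x q1 by simp
  qed
  ultimately show ?case using e by (auto split: if_splits)
qed

lemma cm_class_zero:
  assumes rel: "\<And>q. prime q \<Longrightarrow> \<exists>e. \<forall>m. a q * a m = a (q * m) + (if q dvd m then e * a (m div q) else 0)"
    and mf: "mform k M a h" and M: "M \<ge> 1" "\<And>q. prime q \<Longrightarrow> q dvd M \<Longrightarrow> q dvd E"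
    and E: "E \<ge> 1" "8 dvd E"
    and ch: "nontrivial_quadratic_character D \<phi>"
    and fin: "finite {q. prime q \<and> a q \<noteq> \<phi> q * a q}"
    and n0: "coprime n0 D" "coprime n0 E" "\<phi> n0 = -1" and n: "[n = n0] (mod E)"
  shows "a n = 0"
proof -
  have dc: "dirichlet_character D \<phi>" and D: "D > 0"
    using ch by (auto simp: nontrivial_quadratic_character_def dirichlet_character_def)
  have mult: "\<phi> (x * y) = \<phi> x * \<phi> y" for x y
    using dc by (auto simp: dirichlet_character_def)
  define A where "A = {q. prime q \<and> \<not> q dvd E \<and> (q dvd D \<or> a q \<noteq> \<phi> q * a q)}"
  have "A \<subseteq> {q. q dvd D} \<union> {q. prime q \<and> a q \<noteq> \<phi> q * a q}" by (auto simp: A_def)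
  hence finA: "finite A" by (rule finite_subset) (use fin D in simp)
  have primeA: "prime q" if "q \<in> A" for q using that by (simp add: A_def)
  have "coprime n0 (D * E)" using n0 by simp
  moreover have "\<Prod>A > 0" using finA primeA prime_gt_0_nat by (intro prod_pos) auto
  ultimately obtain r where r: "[r = n0] (mod (D * E))" "coprime r (\<Prod>A)" "coprime r (D * E)"
    by (rule coprime_lift)
  have rD: "[r = n0] (mod D)" and rE: "[r = n0] (mod E)"
    using r(1) cong_modulus_mult_nat by (blast, metis mult.commute cong_modulus_mult_nat)
  have \<phi>r: "\<phi> r = -1" using dirichlet_character_cong[OF dc rD] n0 by simp
  have qr: "\<not> q dvd r" if "q \<in> A" for q
  proof
    assume "q dvd r"
    moreover have "q dvd \<Prod>A" using finA that by (intro dvd_prodI) auto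
    ultimately show False using r(2) primeA[OF that] not_prime_unit coprime_common_divisor by blast
  qed
  define \<psi> :: "nat \<Rightarrow> complex" where "\<psi> = (\<lambda>n. if [n = r] (mod E) then 1 else 0)"
  have all: "\<psi> n * a n = 0" for n
  proof (rule mform_classes_zero[OF finA mform_sieve[OF mf E(1), of \<psi>]])
    show "\<psi> (n mod E) = \<psi> n" for n by (simp add: \<psi>_def cong_def)
    show "M * E ^ 2 \<ge> 1" using M E by simp
    show "prime q \<and> \<not> q dvd M * E ^ 2 \<and> \<not> q dvd r" if "q \<in> A" for q
      using that qr[OF that] M(2)[of q] by (auto simp: A_def prime_dvd_mult_iff prime_dvd_power_iff)
    fix n assume nA: "\<And>q. q \<in> A \<Longrightarrow> [n = r] (mod q)"
    show "\<psi> n * a n = 0"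
    proof (cases "[n = r] (mod E)")
      case True
      have "coprime r E" using r(3) by simp
      hence nE: "coprime n E" using True by (metis cong_imp_coprime cong_sym)
      have n_pos: "n > 0" using nE E by (intro Nat.gr0I) auto
      have pr: "\<not> q dvd E \<and> q \<notin> A" if "prime q" "q dvd n" for q
      proof
        show "\<not> q dvd E" using nE that not_prime_unit coprime_common_divisor by blast
        show "q \<notin> A" using nA[of q] qr[of q] that by (metis cong_dvd_iff)
      qed
      have good: "\<not> q dvd D \<and> a q = \<phi> q * a q" if "prime q" "q dvd n" for q
        using pr[OF that] that by (auto simp: A_def)
      have nD: "coprime n D"
      proof (rule ccontr)
        assume "\<not> coprime n D"
        then obtain q where "prime q" "q dvd n" "q dvd D"
          by (metis coprime_iff_gcd_eq_1 gcd_greatest_iff prime_factor_nat)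
        thus False using good by blast
      qed
      obtain j where j: "j > 0" "[r ^ j = 1] (mod (D * E))"
        using power_cong_1_exists[OF r(3)] D E by auto
      define y where "y = r ^ (2 * j - 1)"
      have "r * y = r ^ Suc (2 * j - 1)" by (simp add: y_def)
      also have "Suc (2 * j - 1) = j * 2" using j by simp
      finally have "r * y = (r ^ j) ^ 2" by (simp add: power_mult)
      hence ry: "[r * y = 1] (mod (D * E))" using cong_pow[OF j(2), of 2] by simp
      have "odd (2 * j - 1)" using j by simp
      hence \<phi>y: "\<phi> y = -1" by (simp add: y_def dirichlet_character_power[OF dc] \<phi>r)
      have ny: "[n * y = 1] (mod q)" if "[n = r] (mod q)" "q dvd D * E" for q
        using cong_trans[OF cong_mult[OF that(1) cong_refl] cong_dvd_modulus_nat[OF ry that(2)]] .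
      have "\<phi> (n * y) = 1"
      proof (rule quadratic_character_eq_1[OF ch])
        show "coprime (n * y) D" using nD r(3) by (simp add: y_def)
        have "[n = r] (mod 8)" using cong_dvd_modulus_nat[OF True E(2)] .
        thus "[n * y = 1] (mod 8)" by (rule ny) (use E(2) in auto)
        show "[n * y = 1] (mod q)" if q: "prime q" "q dvd D" "odd q" for q
        proof (rule ny)
          show "[n = r] (mod q)"
          proof (cases "q dvd E")
            case False
            thus ?thesis using nA[of q] q by (simp add: A_def)
          qed (rule cong_dvd_modulus_nat[OF True])
        qed (use q in auto)
      qed
      hence "\<phi> n = -1" using \<phi>y by (simp add: mult minus_equation_iff)
      hence "a n = 0" using cm_coeff_zero[OF rel ch n_pos _ good] by blast
      thus ?thesis by simp
    qed (simp add: \<psi>_def)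
  qed
  have "[n = r] (mod E)" using n rE by (meson cong_sym cong_trans)
  thus ?thesis using all[of n] by (simp add: \<psi>_def)
qed

lemma cm_character_of_modulus:
  assumes rel: "\<And>q. prime q \<Longrightarrow> \<exists>e. \<forall>m. a q * a m = a (q * m) + (if q dvd m then e * a (m div q) else 0)"
    and mf: "mform k M a h" and a1: "a 1 = 1"
    and M: "M \<ge> 1" "\<And>q. prime q \<Longrightarrow> q dvd M \<Longrightarrow> q dvd E"
    and E: "E \<ge> 1" "8 dvd E"
    and ch: "nontrivial_quadratic_character D \<phi>"
    and fin: "finite {q. prime q \<and> a q \<noteq> \<phi> q * a q}"
  shows "\<exists>\<psi>. nontrivial_quadratic_character E \<psi> \<and> (\<forall>n. \<psi> n = -1 \<longrightarrow> a n = 0)"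
proof -
  have dc: "dirichlet_character D \<phi>" and D: "D > 0"
    using ch by (auto simp: nontrivial_quadratic_character_def dirichlet_character_def)
  have mult: "\<phi> (x * y) = \<phi> x * \<phi> y" for x y
    using dc by (auto simp: dirichlet_character_def)
  have zero: "a n = 0" if "coprime n0 D" "coprime n0 E" "\<phi> n0 = -1" "[n = n0] (mod E)" for n0 n
    by (rule cm_class_zero[OF _ mf M(1) _ E ch fin that]) (erule rel, erule (1) M(2))
  note vals = quadratic_character_values[OF ch]
  have one: "\<phi> z = 1" if "coprime z D" "coprime z E" "[z = 1] (mod E)" for z
    using zero[of z 1] that vals[of z] a1 cong_sym by force
  have eq: "\<phi> x = \<phi> y" if "coprime x D" and yD: "coprime y D" and yE: "coprime y E" and xy: "[x = y] (mod E)" for x y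
  proof -
    have xE: "coprime x E" using yE xy by (metis cong_imp_coprime cong_sym)
    obtain j where j: "j > 0" "[y ^ j = 1] (mod E)"
      using power_cong_1_exists[OF yE E(1)] by auto
    define y' where "y' = y ^ (2 * j - 1)"
    have "y * y' = y ^ Suc (2 * j - 1)" by (simp add: y'_def)
    also have "Suc (2 * j - 1) = j * 2" using j by simp
    finally have "y * y' = (y ^ j) ^ 2" by (simp add: power_mult)
    hence "[y * y' = 1] (mod E)" using cong_pow[OF j(2), of 2] by simp
    hence "[x * y' = 1] (mod E)" using cong_trans[OF cong_mult[OF xy cong_refl]] by blast
    hence "\<phi> (x * y') = 1" by (rule one[rotated 2]) (use that yD yE xE in \<open>auto simp: y'_def\<close>)
    moreover have "\<phi> y' = \<phi> y"
      using vals[OF yD] j by (auto simp: y'_def dirichlet_character_power[OF dc])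
    ultimately show ?thesis using vals[OF yD] by (auto simp: mult minus_equation_iff)
  qed
  have "\<exists>n'. coprime n E \<longrightarrow> [n' = n] (mod E) \<and> coprime n' D \<and> coprime n' E" for n
    using coprime_lift[OF _ D, of n E] by metis
  then obtain lift where lift: "\<And>n. coprime n E \<Longrightarrow> [lift n = n] (mod E)"
    "\<And>n. coprime n E \<Longrightarrow> coprime (lift n) D" "\<And>n. coprime n E \<Longrightarrow> coprime (lift n) E" by metis
  define \<psi> where "\<psi> = (\<lambda>n. if coprime n E then \<phi> (lift n) else 0)"
  have \<psi>_eq: "\<psi> n = \<phi> n'" if "coprime n' D" "coprime n' E" "[n' = n] (mod E)" for n n'
  proof -
    have n: "coprime n E" using that cong_imp_coprime by blast
    have "\<phi> (lift n) = \<phi> n'"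
      by (rule eq) (use that lift[OF n] in \<open>auto intro: cong_trans simp: cong_sym_eq\<close>)
    thus ?thesis using n by (simp add: \<psi>_def)
  qed
  have \<psi>_vals: "\<psi> n = 1 \<or> \<psi> n = -1" if "coprime n E" for n
    using vals[OF lift(2)[OF that]] that by (simp add: \<psi>_def)
  have "dirichlet_character E \<psi>"
    unfolding dirichlet_character_def
  proof (intro conjI allI)
    show "\<psi> 1 = 1" using \<psi>_eq[of 1 1] dc by (simp add: dirichlet_character_def)
    show "\<psi> (x * y) = \<psi> x * \<psi> y" for x y
    proof (cases "coprime x E \<and> coprime y E")
      case True
      have "\<psi> (x * y) = \<phi> (lift x * lift y)"
        by (rule \<psi>_eq) (use lift True in \<open>auto intro: cong_mult\<close>)
      thus ?thesis using True by (simp add: mult \<psi>_def)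
    qed (auto simp: \<psi>_def)
    show "\<psi> (x + E) = \<psi> x" for x
    proof (cases "coprime x E")
      case True
      have "\<psi> (x + E) = \<phi> (lift x)"
        by (rule \<psi>_eq) (use lift[OF True] in \<open>auto simp: cong_def\<close>)
      thus ?thesis using True by (simp add: \<psi>_def)
    qed (simp add: \<psi>_def coprime_iff_gcd_eq_1)
    show "\<psi> x \<noteq> 0 \<longleftrightarrow> coprime x E" for x
      using \<psi>_vals[of x] by (auto simp: \<psi>_def)
  qed (use E in simp)
  moreover have "\<psi> x ^ 2 = 1" if "coprime x E" for x using \<psi>_vals[OF that] by auto
  moreover have "\<exists>x. coprime x E \<and> \<psi> x \<noteq> 1"
  proof -
    from ch obtain z where z: "coprime z D" "\<phi> z \<noteq> 1"
      by (auto simp: nontrivial_quadratic_character_def)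
    have "E > 0" using E by simp
    with z(1) obtain z' where z': "[z' = z] (mod D)" "coprime z' E" "coprime z' D"
      by (rule coprime_lift)
    have "\<psi> z' = \<phi> z'" by (rule \<psi>_eq) (use z' in auto)
    also have "\<dots> = \<phi> z" by (rule dirichlet_character_cong[OF dc z'(1)])
    finally show ?thesis using z z' by auto
  qed
  moreover have "a n = 0" if "\<psi> n = -1" for n
  proof -
    have n: "coprime n E" using that by (auto simp: \<psi>_def split: if_splits)
    show ?thesis
      by (rule zero[OF lift(2)[OF n] lift(3)[OF n]]) (use that n lift(1)[OF n] in \<open>auto simp: \<psi>_def cong_sym_eq\<close>)
  qed
  ultimately show ?thesis unfolding nontrivial_quadratic_character_def by blast
qed

lemma finite_quadratic_characters: "finite {\<psi>. nontrivial_quadratic_character E \<psi>}"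
proof (cases "E = 0")
  case True
  thus ?thesis by (simp add: nontrivial_quadratic_character_def dirichlet_character_def)
next
  case False
  let ?X = "{\<psi>. nontrivial_quadratic_character E \<psi>}"
  have "(\<lambda>\<psi>. restrict \<psi> {..<E}) ` ?X \<subseteq> (\<Pi>\<^sub>E i\<in>{..<E}. {-1, 0, 1})"
  proof
    fix \<eta> assume "\<eta> \<in> (\<lambda>\<psi>. restrict \<psi> {..<E}) ` ?X"
    then obtain \<psi> where \<psi>: "nontrivial_quadratic_character E \<psi>" "\<eta> = restrict \<psi> {..<E}" by blast
    have "\<psi> n \<in> {-1, 0, 1}" for n
      using quadratic_character_values[OF \<psi>(1), of n] \<psi>(1)
      by (auto simp: nontrivial_quadratic_character_def dirichlet_character_def)
    thus "\<eta> \<in> (\<Pi>\<^sub>E i\<in>{..<E}. {-1, 0, 1})" using \<psi>(2) by auto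
  qed
  hence "finite ((\<lambda>\<psi>. restrict \<psi> {..<E}) ` ?X)"
    by (rule finite_subset) (intro finite_PiE, auto)
  moreover have "inj_on (\<lambda>\<psi>. restrict \<psi> {..<E}) ?X"
  proof (rule inj_onI, rule ext)
    fix \<psi> \<psi>' n
    assume *: "\<psi> \<in> ?X" "\<psi>' \<in> ?X" "restrict \<psi> {..<E} = restrict \<psi>' {..<E}"
    have dc: "dirichlet_character E \<psi>" "dirichlet_character E \<psi>'"
      using * by (auto simp: nontrivial_quadratic_character_def)
    have "\<psi> (n mod E) = \<psi>' (n mod E)"
      using fun_cong[OF *(3), of "n mod E"] False by simp
    thus "\<psi> n = \<psi>' n"
      using dirichlet_character_cong[OF dc(1), of "n mod E" n] dirichlet_character_cong[OF dc(2), of "n mod E" n]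
      by simp
  qed
  ultimately show ?thesis by (rule finite_imageD)
qed

subsection \<open>Congruences at a prime above \<open>p\<close>\<close>

lemma primes_above_QbarD:
  assumes P: "P \<in> primes_above p Qbar"
  defines "Z \<equiv> integers_of Qbar"
  shows "\<And>x y. x \<in> Z \<Longrightarrow> y \<in> Z \<Longrightarrow> x + y \<in> Z"
    and "\<And>x y. x \<in> Z \<Longrightarrow> y \<in> Z \<Longrightarrow> x * y \<in> Z"
    and "\<And>x y. x \<in> Z \<Longrightarrow> y \<in> P \<Longrightarrow> x * y \<in> P"
    and "\<And>x y. x \<in> P \<Longrightarrow> y \<in> P \<Longrightarrow> x + y \<in> P"
    and "\<And>x y. x \<in> Z \<Longrightarrow> y \<in> Z \<Longrightarrow> x * y \<in> P \<Longrightarrow> x \<in> P \<or> y \<in> P"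
    and "1 \<notin> P" and "of_nat p \<in> P"
proof -
  define R where "R = complex_ring\<lparr>carrier := Z\<rparr>"
  have sel [simp]: "carrier R = Z" "mult R = (*)" "add R = (+)" "one R = 1"
    by (simp_all add: R_def complex_ring_def)
  interpret primeideal P R using P by (simp add: primes_above_def R_def Z_def)
  show "x + y \<in> Z" if "x \<in> Z" "y \<in> Z" for x y using add.m_closed[of x y] that by simp
  show "x * y \<in> Z" if "x \<in> Z" "y \<in> Z" for x y using m_closed[of x y] that by simp
  show l: "x * y \<in> P" if "x \<in> Z" "y \<in> P" for x y using I_l_closed[of y x] that by simp
  show "x + y \<in> P" if "x \<in> P" "y \<in> P" for x y using subgroup.m_closed[OF a_subgroup, of x y] that by simp
  show "x \<in> P \<or> y \<in> P" if "x \<in> Z" "y \<in> Z" "x * y \<in> P" for x y using I_prime[of x y] that by simp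
  show "1 \<notin> P"
  proof
    assume "1 \<in> P"
    hence "Z \<subseteq> P" using l[of _ 1] by auto
    moreover have "P \<subseteq> Z" using a_subset by simp
    ultimately show False using I_notcarr by simp
  qed
  show "of_nat p \<in> P" using P by (simp add: primes_above_def)
qed

lemma algebraic_int_in_Z: "algebraic_int x \<Longrightarrow> x \<in> integers_of Qbar"
  by (auto simp: integers_of_def Qbar_def)

lemma root_of_unity_algebraic_int:
  assumes "x ^ j = (1::complex)" "j > 0"
  shows "algebraic_int x"
proof (rule algebraic_int.intros[of "Polynomial.monom 1 j - 1"])
  have "degree (Polynomial.monom 1 j - 1 :: complex poly) = j"
    using degree_add_eq_left[of "-1" "Polynomial.monom 1 j :: complex poly"] assms(2) by (simp add: degree_monom_eq)
  thus "lead_coeff (Polynomial.monom 1 j - 1 :: complex poly) = 1" using assms(2) by simp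
  show "\<forall>i. poly.coeff (Polynomial.monom 1 j - 1 :: complex poly) i \<in> \<int>" by (auto simp: coeff_1)
qed (use assms in \<open>simp add: poly_monom\<close>)

locale prime_above =
  fixes P :: "complex set" and p :: nat
  assumes P: "P \<in> primes_above p Qbar" and p: "prime p"
begin

abbreviation Z where "Z \<equiv> integers_of Qbar"

lemmas Z_add = primes_above_QbarD(1)[OF P]
  and Z_mult = primes_above_QbarD(2)[OF P]
  and P_mult = primes_above_QbarD(3)[OF P]
  and P_add = primes_above_QbarD(4)[OF P]
  and P_prime = primes_above_QbarD(5)[OF P]
  and one_notin_P = primes_above_QbarD(6)[OF P]
  and p_in_P = primes_above_QbarD(7)[OF P]

lemma Z_of_int: "of_int n \<in> Z"
  by (intro algebraic_int_in_Z int_imp_algebraic_int) auto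

lemma Z_of_nat: "of_nat n \<in> Z"
  using Z_of_int[of "int n"] by simp

lemma Z_power: "x \<in> Z \<Longrightarrow> x ^ n \<in> Z"
  by (induction n) (use Z_mult Z_of_nat[of 1] in auto)

lemma of_int_notin_P:
  assumes "coprime n (int p)"
  shows "of_int n \<notin> P"
proof
  assume *: "of_int n \<in> P"
  obtain u v where uv: "u * n + v * int p = 1"
    using bezout_int[of n "int p"] assms by (auto simp: coprime_iff_gcd_eq_1)
  have "of_int u * of_int n + of_int v * of_nat p \<in> P"
    by (intro P_add P_mult Z_of_int * p_in_P)
  also have "of_int u * of_int n + of_int v * of_nat p = (of_int (u * n + v * int p) :: complex)"
    by simp
  finally show False using uv one_notin_P by simp
qed

definition small :: "nat \<Rightarrow> complex set" where
  "small m = {x. \<exists>s \<in> Z - P. \<exists>t \<in> Z. s * x = of_nat p ^ m * t}"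

lemma cong_at_iff_small: "cong_at P p m x y \<longleftrightarrow> x - y \<in> small m"
  by (simp add: cong_at_def small_def)

lemma ZP_mult: "s \<in> Z - P \<Longrightarrow> s' \<in> Z - P \<Longrightarrow> s * s' \<in> Z - P"
  using Z_mult P_prime by blast

lemma small_add:
  assumes "x \<in> small m" "y \<in> small m"
  shows "x + y \<in> small m"
proof -
  from assms obtain s t s' t' where *: "s \<in> Z - P" "t \<in> Z" "s * x = of_nat p ^ m * t"
    "s' \<in> Z - P" "t' \<in> Z" "s' * y = of_nat p ^ m * t'" by (auto simp: small_def)
  have "(s * s') * (x + y) = s' * (s * x) + s * (s' * y)" by (simp add: algebra_simps)
  also have "\<dots> = of_nat p ^ m * (s' * t + s * t')" unfolding * by (simp add: algebra_simps)
  finally have "(s * s') * (x + y) = of_nat p ^ m * (s' * t + s * t')" .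
  moreover have "s' * t + s * t' \<in> Z" using * Z_add Z_mult by blast
  ultimately show ?thesis using ZP_mult[OF *(1,4)] unfolding small_def by blast
qed

lemma small_mult:
  assumes "x \<in> small m" "y \<in> small n"
  shows "x * y \<in> small (m + n)"
proof -
  from assms obtain s t s' t' where *: "s \<in> Z - P" "t \<in> Z" "s * x = of_nat p ^ m * t"
    "s' \<in> Z - P" "t' \<in> Z" "s' * y = of_nat p ^ n * t'" by (auto simp: small_def)
  have "(s * s') * (x * y) = (s * x) * (s' * y)" by (simp add: algebra_simps)
  also have "\<dots> = of_nat p ^ (m + n) * (t * t')" unfolding * by (simp add: power_add algebra_simps)
  finally have "(s * s') * (x * y) = of_nat p ^ (m + n) * (t * t')" .
  moreover have "t * t' \<in> Z" using * Z_mult by blast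
  ultimately show ?thesis using ZP_mult[OF *(1,4)] unfolding small_def by blast
qed

lemma Z_small_0: "x \<in> Z \<Longrightarrow> x \<in> small 0"
  using one_notin_P Z_of_nat[of 1] by (auto simp: small_def intro!: bexI[of _ 1])

lemma small_mono: "x \<in> small m \<Longrightarrow> n \<le> m \<Longrightarrow> x \<in> small n"
proof -
  assume "x \<in> small m" "n \<le> m"
  then obtain s t where "s \<in> Z - P" "t \<in> Z" "s * x = of_nat p ^ m * t" by (auto simp: small_def)
  moreover have "(of_nat p ^ m * t :: complex) = of_nat p ^ n * (of_nat p ^ (m - n) * t)"
    using \<open>n \<le> m\<close> by (simp add: power_add[symmetric] mult.assoc[symmetric])
  moreover have "of_nat p ^ (m - n) * t \<in> Z" using \<open>t \<in> Z\<close> Z_mult Z_power Z_of_nat by blast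
  ultimately show ?thesis unfolding small_def by auto
qed

lemma small_mult_left: "x \<in> small 0 \<Longrightarrow> y \<in> small m \<Longrightarrow> x * y \<in> small m"
  using small_mult[of x 0 y m] by simp

lemma of_nat_notin_small:
  assumes "coprime q p"
  shows "of_nat q ^ n \<notin> small 1"
proof
  assume "of_nat q ^ n \<in> small 1"
  then obtain s t where s: "s \<in> Z - P" "t \<in> Z" "s * of_nat q ^ n = of_nat p * t"
    by (auto simp: small_def)
  have "t * of_nat p \<in> P" by (rule P_mult[OF s(2) p_in_P])
  hence "s * of_nat q ^ n \<in> P" using s(3) by (simp add: mult.commute)
  moreover have "of_nat q ^ n \<in> Z" using Z_power Z_of_nat by blast
  ultimately have "of_nat q ^ n \<in> P" using P_prime s by blast
  moreover have "of_int (int q ^ n) \<notin> P" by (rule of_int_notin_P) (use assms in simp)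
  ultimately show False by simp
qed

lemma small_all_imp_0:
  assumes inf: "infinite {m. x \<in> small m}"
  shows "x = 0"
proof (rule ccontr)
  assume x: "x \<noteq> 0"
  from not_finite_existsD[OF inf] obtain m0 where "x \<in> small m0" by blast
  hence "x \<in> small 0" using small_mono by blast
  then obtain s0 y where s0: "s0 \<in> Z - P" "y \<in> Z" "s0 * x = y" by (auto simp: small_def)
  have "0 \<in> P" using P_mult[OF Z_of_int[of 0] p_in_P] by simp
  hence "s0 \<noteq> 0" using s0 by auto
  hence y0: "y \<noteq> 0" using s0 x by auto
  have "algebraic_int y" using s0 by (simp add: integers_of_def)
  then obtain f :: "complex poly" where f: "lead_coeff f = 1" "\<forall>i. poly.coeff f i \<in> \<int>" "poly f y = 0"
    by (auto elim: algebraic_int.cases)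
  have "\<exists>c v. c \<noteq> (0::int) \<and> v \<in> Z \<and> of_int c = y * v"
    if "f \<noteq> 0" "\<forall>i. poly.coeff f i \<in> \<int>" "poly f y = 0" for f :: "complex poly"
    using that
  proof (induction f)
    case (pCons a f)
    have fi: "\<forall>i. poly.coeff f i \<in> \<int>" using pCons.prems(2) by (metis coeff_pCons_Suc)
    have a: "a \<in> \<int>" using pCons.prems(2) by (metis coeff_pCons_0)
    have eq: "a + y * poly f y = 0" using pCons.prems(3) by simp
    show ?case
    proof (cases "a = 0")
      case True
      with eq y0 pCons.prems(1) fi show ?thesis by (intro pCons.IH) auto
    next
      case False
      have "poly g y \<in> Z" if "\<forall>i. poly.coeff g i \<in> \<int>" for g
        using that
      proof (induction g)
        case 0
        show ?case using Z_of_int[of 0] by simp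
      next
        case (pCons b g)
        have "\<forall>i. poly.coeff g i \<in> \<int>" "b \<in> \<int>"
          using pCons.prems by (metis coeff_pCons_Suc, metis coeff_pCons_0)
        hence "poly g y \<in> Z" "b \<in> Z" using pCons.IH Z_of_int by (auto elim: Ints_cases)
        thus ?case using Z_add Z_mult s0(2) by simp
      qed
      hence "poly f y \<in> Z" using fi by blast
      hence "- 1 * poly f y \<in> Z" using Z_mult Z_of_int[of "-1"] by fastforce
      moreover from a obtain c where "a = of_int c" by (auto elim: Ints_cases)
      moreover have "a = y * (- 1 * poly f y)" using eq by (simp add: add_eq_0_iff2)
      ultimately show ?thesis using False by (intro exI[of _ c] exI[of _ "- 1 * poly f y"]) auto
    qed
  qed simp
  moreover have "f \<noteq> 0" using f by auto
  ultimately obtain c v where c: "c \<noteq> 0" "v \<in> Z" "of_int c = y * v" using f by blast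
  obtain c' where c': "c = int p ^ multiplicity (int p) c * c'" "\<not> int p dvd c'"
  proof -
    have "\<not> is_unit (int p)" using p by (metis not_prime_unit prime_nat_int_transfer)
    thus thesis by (rule multiplicity_decompose'[OF c(1)]) (rule that)
  qed
  define e where "e = multiplicity (int p) c"
  obtain m where m: "x \<in> small m" "m > e"
    using inf unfolding infinite_nat_iff_unbounded by blast
  then obtain s t where s: "s \<in> Z - P" "t \<in> Z" "s * x = of_nat p ^ m * t" by (auto simp: small_def)
  have "(of_int c :: complex) = of_int (int p ^ e * c')" using c'(1) by (simp only: e_def[symmetric])
  hence "of_nat p ^ e * (s * of_int c') = s * of_int c" by simp
  also have "\<dots> = (s * x) * s0 * v" unfolding c(3) s0(3)[symmetric] by simp
  also have "\<dots> = of_nat p ^ e * (of_nat p ^ (m - e) * t * s0 * v)"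
    unfolding s(3) using m(2) by (simp add: power_add[symmetric] mult.assoc[symmetric])
  finally have "s * of_int c' = of_nat p ^ (m - e) * t * s0 * v"
    using p by (simp add: prime_gt_0_nat)
  also have "\<dots> = (of_nat p ^ (m - e - 1) * t * s0 * v) * of_nat p"
    using m(2) by (cases "m - e") auto
  also have "\<dots> \<in> P" using s s0 c by (intro P_mult[OF _ p_in_P] Z_mult Z_power Z_of_nat) auto
  finally have "of_int c' \<in> P" using P_prime s Z_of_int by blast
  moreover have "coprime c' (int p)"
    using c'(2) p by (metis coprime_commute prime_imp_coprime prime_nat_int_transfer)
  ultimately show False using of_int_notin_P by blast
qed

text \<open>If \<open>x\<close>, \<open>x\<^sup>2 - e\<close>, \<open>x\<^sup>3 - 2ex\<close> are congruent to \<open>y\<close>, \<open>y\<^sup>2\<close>, \<open>y\<^sup>3\<close>, put \<open>\<delta> = x - y\<close> and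
  \<open>w = 2y\<delta>\<close>. The second congruence gives \<open>w \<equiv> e\<close>, and \<open>4\<delta>\<close> times the third becomes
  \<open>3w\<^sup>2 - 4ew \<equiv> 0\<close>. No integrality of \<open>x\<close> and \<open>y\<close> is needed.\<close>

lemma euler_factors_congruent_imp:
  assumes e: "e \<in> Z"
    and 1: "x - y \<in> small 1" and 2: "x ^ 2 - e - y ^ 2 \<in> small 1"
    and 3: "x ^ 3 - 2 * e * x - y ^ 3 \<in> small 1"
  shows "e ^ 2 \<in> small 1"
proof -
  define d where "d = x - y"
  define \<alpha> where "\<alpha> = x ^ 2 - e - y ^ 2"
  define \<beta> where "\<beta> = x ^ 3 - 2 * e * x - y ^ 3"
  have s: "d \<in> small 1" "\<alpha> \<in> small 1" "\<beta> \<in> small 1" using 1 2 3 by (auto simp: d_def \<alpha>_def \<beta>_def)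
  hence s0: "d \<in> small 0" "\<alpha> \<in> small 0" "\<beta> \<in> small 0" "e \<in> small 0"
    using small_mono Z_small_0[OF e] by auto
  have n: "of_int i \<in> small 0" for i using Z_small_0 Z_of_int by blast
  have "e ^ 2 = (d * d * d + of_int (-4) * e * d + of_int (-4) * \<beta>) * d + (of_int 2 * e + of_int 3 * \<alpha>) * \<alpha>"
    by (simp add: d_def \<alpha>_def \<beta>_def power2_eq_square power3_eq_cube algebra_simps)
  also have "\<dots> \<in> small 1"
    by (intro small_add small_mult_left s s0 n)
  finally show ?thesis .
qed

end

lemma (in prime_above) companion_level_primes:
  assumes k: "k \<ge> 2" and N: "N \<ge> 1" and M: "M \<ge> 1" and m: "m \<ge> 1"
    and f: "cuspidal_eigenform k N f" "normalised f"
    and comp: "companion_form P p m k N f M h"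
    and q: "prime q" "q dvd M"
  shows "q dvd N * p"
proof (rule ccontr)
  assume nd: "\<not> q dvd N * p"
  hence qN: "\<not> q dvd N" by auto
  have cop: "coprime q (N * p)" using q nd by (intro prime_imp_coprime)
  have q0: "q > 0" using q prime_gt_0_nat by blast
  define a where "a = fourier_coeff f"
  define b where "b = fourier_coeff h"
  have a1: "a 1 = 1" using f by (simp add: a_def normalised_def)
  have h: "cuspidal_eigenform (companion_weight p m k) M h" "normalised h"
    using comp by (auto simp: companion_form_def)
  obtain \<epsilon> where \<epsilon>: "\<exists>j>0. \<epsilon> ^ j = 1"
    and rel: "\<And>n. a q * a n = a (q * n) +
      (if q dvd n \<and> \<not> q dvd N then \<epsilon> * of_nat q powi (int k - 1) * a (n div q) else 0)"
    unfolding a_def by (rule hecke_relation[OF f N q(1)]) blast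
  have bq: "b (q * n) = b q * b n" for n
    unfolding b_def by (rule hecke_relation[OF h M q(1)]) (use q(2) in simp)
  define e where "e = \<epsilon> * of_nat q ^ (k - 1)"
  have "int k - 1 = int (k - 1)" using k by simp
  hence e_eq: "\<epsilon> * of_nat q powi (int k - 1) = e"
    unfolding e_def by (simp only: power_int_of_nat)
  have a2: "a (q * q) = a q ^ 2 - e"
    using rel[of q] a1 q0 qN by (simp add: e_eq power2_eq_square)
  have a3: "a (q * (q * q)) = a q ^ 3 - 2 * e * a q"
    using rel[of "q * q"] a2 q0 qN by (simp add: e_eq power2_eq_square power3_eq_cube algebra_simps)
  define y where "y = of_nat q ^ (k - 1) * b q"
  have cong: "a n - of_nat n ^ (k - 1) * b n \<in> small 1" if "coprime n (N * p)" for n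
  proof -
    have "a n - of_nat n ^ (k - 1) * b n \<in> small m"
      using comp that by (simp add: companion_form_def cong_at_iff_small a_def b_def)
    thus ?thesis using small_mono m by blast
  qed
  obtain j where j: "j > 0" "\<epsilon> ^ j = 1" using \<epsilon> by blast
  have \<epsilon>Z: "\<epsilon> \<in> Z" by (intro algebraic_int_in_Z root_of_unity_algebraic_int[OF j(2,1)])
  have eZ: "e \<in> Z" unfolding e_def by (intro Z_mult Z_power Z_of_nat \<epsilon>Z)
  have "e ^ 2 \<in> small 1"
  proof (rule euler_factors_congruent_imp[OF eZ, of "a q" y])
    show "a q - y \<in> small 1" unfolding y_def by (rule cong[OF cop])
    show "a q ^ 2 - e - y ^ 2 \<in> small 1"
      using cong[of "q * q"] cop by (simp add: a2 bq y_def power_mult_distrib power2_eq_square mult_ac)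
    show "a q ^ 3 - 2 * e * a q - y ^ 3 \<in> small 1"
      using cong[of "q * (q * q)"] cop
      by (simp add: a3 bq y_def power_mult_distrib power3_eq_cube mult_ac)
  qed
  moreover have "(\<epsilon> ^ (j - 1)) ^ 2 \<in> small 0" by (intro Z_small_0 Z_power \<epsilon>Z)
  ultimately have "(\<epsilon> ^ (j - 1)) ^ 2 * e ^ 2 \<in> small 1" using small_mult_left by blast
  also have "(\<epsilon> ^ (j - 1)) ^ 2 * e ^ 2 = (\<epsilon> ^ (j - 1) * \<epsilon>) ^ 2 * (of_nat q ^ (k - 1)) ^ 2"
    by (simp add: e_def power_mult_distrib mult_ac)
  also have "\<epsilon> ^ (j - 1) * \<epsilon> = 1" using j by (metis power_minus_mult)
  finally have "of_nat q ^ ((k - 1) * 2) \<in> small 1" by (simp add: power_mult)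
  thus False using of_nat_notin_small[of q] cop by simp
qed

theorem theorem4p2:
  fixes p k N :: nat and f :: "complex \<Rightarrow> complex" and P :: "complex set"
  assumes "prime p" and "p \<ge> 3"
    and "P \<in> primes_above p Qbar"
    and "k \<ge> 2" and "N \<ge> 1" and "coprime N p"
    and "primitive_form k N f" and "p_ordinary p f"
    and "\<forall>m \<ge> 1. \<exists>M h. M \<ge> 1 \<and> companion_form P p m k N f M h \<and> has_CM h"
  shows "has_CM f"
proof -
  interpret prime_above P p by unfold_locales (use assms in auto)
  have f: "cuspidal_eigenform k N f" "normalised f"
    using assms(7) by (auto simp: primitive_form_def)
  define E where "E = 8 * (N * p)"
  have E: "E \<ge> 1" "8 dvd E" using assms(5) prime_gt_0_nat[OF assms(1)] by (auto simp: E_def)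
  define R where "R = (\<lambda>m (\<psi> :: nat \<Rightarrow> complex). \<forall>n. \<psi> n = -1 \<longrightarrow> fourier_coeff f n \<in> small m)"
  have "\<exists>\<psi>\<in>{\<psi>. nontrivial_quadratic_character E \<psi>}. R m \<psi>" if m: "m \<in> {1..}" for m
  proof -
    have m1: "m \<ge> 1" using m by simp
    then obtain M h where M: "M \<ge> 1" and comp: "companion_form P p m k N f M h" and "has_CM h"
      using assms(9) by blast
    then obtain D \<phi> where ch: "nontrivial_quadratic_character D \<phi>" and cm: "has_CM_by h \<phi>"
      by (auto simp: has_CM_def)
    define k' where "k' = companion_weight p m k"
    have h: "cuspidal_eigenform k' M h" "normalised h"
      using comp by (auto simp: companion_form_def k'_def)
    define a where "a = fourier_coeff h"
    have rel: "\<exists>e. \<forall>n. a q * a n = a (q * n) + (if q dvd n then e * a (n div q) else 0)" if q: "prime q" for q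
    proof -
      obtain \<epsilon> where "\<And>n. a q * a n = a (q * n) +
          (if q dvd n \<and> \<not> q dvd M then \<epsilon> * of_nat q powi (int k' - 1) * a (n div q) else 0)"
        unfolding a_def by (rule hecke_relation[OF h M q]) blast
      thus ?thesis
        by (intro exI[of _ "if q dvd M then 0 else \<epsilon> * of_nat q powi (int k' - 1)"]) auto
    qed
    have mf: "mform k' M a h"
      unfolding a_def by (rule cusp_form_mform[OF _ M]) (use h in \<open>simp add: cuspidal_eigenform_def\<close>)
    have a1: "a 1 = 1" using h by (simp add: a_def normalised_def)
    have ME: "q dvd E" if "prime q" "q dvd M" for q
      using companion_level_primes[OF assms(4,5) M m1 f comp that] by (simp add: E_def)
    have fin: "finite {q. prime q \<and> a q \<noteq> \<phi> q * a q}"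
      using cm by (simp add: has_CM_by_def a_def)
    have "\<exists>\<psi>. nontrivial_quadratic_character E \<psi> \<and> (\<forall>n. \<psi> n = -1 \<longrightarrow> a n = 0)"
      by (rule cm_character_of_modulus[OF _ mf a1 M _ E ch fin]) (erule rel, erule (1) ME)
    then obtain \<psi> where \<psi>: "nontrivial_quadratic_character E \<psi>" "\<And>n. \<psi> n = -1 \<Longrightarrow> a n = 0"
      by blast
    have "fourier_coeff f n \<in> small m" if n: "\<psi> n = -1" for n
    proof -
      have "\<psi> n \<noteq> 0" using n by simp
      hence "coprime n E"
        using \<psi>(1) by (simp add: nontrivial_quadratic_character_def dirichlet_character_def)
      hence "coprime n (N * p)" by (simp add: E_def)
      hence "cong_at P p m (fourier_coeff f n) (of_nat n ^ (k - 1) * a n)"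
        using comp by (simp add: companion_form_def a_def)
      thus ?thesis using \<psi>(2)[OF n] by (simp add: cong_at_iff_small)
    qed
    thus ?thesis using \<psi>(1) by (auto simp: R_def)
  qed
  hence "\<exists>\<psi>\<in>{\<psi>. nontrivial_quadratic_character E \<psi>}. infinite {m \<in> {1..}. R m \<psi>}"
    by (intro pigeonhole_infinite_rel finite_quadratic_characters) (auto simp: infinite_Ici)
  then obtain \<psi> where \<psi>: "nontrivial_quadratic_character E \<psi>" and inf: "infinite {m \<in> {1..}. R m \<psi>}"
    by blast
  have zero: "fourier_coeff f n = 0" if "\<psi> n = -1" for n
  proof (rule small_all_imp_0)
    have "{m \<in> {1..}. R m \<psi>} \<subseteq> {m. fourier_coeff f n \<in> small m}"
      using that by (auto simp: R_def)
    thus "infinite {m. fourier_coeff f n \<in> small m}" using inf finite_subset by blast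
  qed
  have "{q. prime q \<and> fourier_coeff f q \<noteq> \<psi> q * fourier_coeff f q} \<subseteq> {q. q dvd E}"
  proof clarify
    fix q assume q: "prime q" "fourier_coeff f q \<noteq> \<psi> q * fourier_coeff f q"
    show "q dvd E"
    proof (rule ccontr)
      assume "\<not> q dvd E"
      hence "coprime q E" using q by (simp add: prime_imp_coprime)
      from quadratic_character_values[OF \<psi> this] zero[of q] q(2) show False by auto
    qed
  qed
  hence "has_CM_by f \<psi>"
    unfolding has_CM_by_def by (rule finite_subset) (use E in simp)
  thus ?thesis using \<psi> by (auto simp: has_CM_def)
qed

end
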